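(* Let $G$ be a hyperbolic group and let $N_3=N_0+21\delta$. For every $N\ge N_3$, the sequence of covers $(\mathcal S_n)_{n\geq 0}$, where $\mathcal S_n=\{S_g: g\in G, |g|=n\}$, together with the type function $T=T^b_N$, is a quasi-$G$-invariant system of covers of $\partial G$.
   Context: $G$ is hyperbolic with a fixed finite generating set; $d$ is the word metric, $|x|=d(x,e)$; geodesics are isometric embeddings of intervals of $\mathbb Z$ into $G$. $\delta\ge1$ is such that the Cayley graph is $\delta$-hyperbolic (in particular each side of a geodesic triangle with vertices in $G\cup\partial G$, $p$ of them in $\partial G$, lies in the $4(p+1)\delta$-neighbourhood of the union of the other two sides). $\partial G$ is the Gromov boundary with a fixed visual metric and the natural action of $G$. The cone type $T^c(x)$ is the set of $y\in G$ such that some geodesic from $e$ to $xy$ passes through $x$. The ball $N$-type $T^b_N(x)$ is the function $y\mapsto|xy|-|x|$ on $B_N(e)=\{y\in G:|y|\le N\}$. $N_0$ is a constant depending only on $G$ such that for all $N\ge N_0$ and $x,y\in G$, $T^b_N(x)=T^b_N(y)$ implies $T^c(x)=T^c(y)$. $\operatorname{span}(g)$ is the set of $x\in\partial G$ such that some geodesic from $e$ to $x$ passes through $g$. $S_g$ is the interior in $\partial G$ of $\bigcup_{h\in I(g)}\operatorname{span}(gh)$, where $I(g)=\{h\in G: |gh|=|g|,\ \operatorname{span}(gh)\cap\operatorname{span}(g)\ne\emptyset\}$. Let $X$ be a metric space with an action of $G$ by homeomorphisms. A type function on $G$ is a function on $G$ with values in a finite set. A family $\mathcal C=\{C_x\}_{x\in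 G}$ of subsets of $X$, with $\mathcal C_n=\{C_x:|x|=n\}$, is quasi-$G$-invariant with respect to a type function $T$ if there are constants $D>0$ (neighbourhood constant) and $J>0$ (jump constant) such that: (1) $\lim_{n\to\infty}\max_{C\in\mathcal C_n}\operatorname{diam}C=0$; (2) if $|x|=|y|$ and $C_x\cap C_y\ne\emptyset$, then $d(x,y)\le D$; (3) for every $x\in G$ and integer $0<k\le|x|/J$ there is $y\in G$ with $|y|=|x|-kJ$ and $C_y\supseteq C_x$; (4) whenever $T(x)=T(gx)$ for $g,x\in G$: (a) $C_{gx}=g\cdot C_x$; (b) for every $y$ with $|y|=|x|$ and $C_x\cap C_y\neq\emptyset$ we have $C_{gy}=g\cdot C_y$ and $|gy|=|gx|$; (c) for every $y$ with $|y|=|x|+kJ$ for some integer $k>0$ and $\emptyset\ne C_y\subseteq C_x$ we have $|gy|=|gx|+kJ$, $T(gy)=T(y)$, and so $C_{gy}=g\cdot C_y$. It is a system of covers if each $\mathcal C_n$ is an open cover of $X$. *)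

theory Defs
  imports "HOL-Analysis.Analysis" "HOL-Algebra.Group_Action" "HOL-Algebra.Generated_Groups"
begin

section \<open>Word metric, hyperbolicity, geodesics\<close>

definition word_length :: "('g, 'm) monoid_scheme \<Rightarrow> 'g set \<Rightarrow> 'g \<Rightarrow> nat" where
  "word_length G S x =
     (LEAST n. \<exists>ws. length ws = n \<and> set ws \<subseteq> S \<union> m_inv G ` S \<and>
                    foldr (\<lambda>a b. a \<otimes>\<^bsub>G\<^esub> b) ws \<one>\<^bsub>G\<^esub> = x)"

definition word_dist :: "('g, 'm) monoid_scheme \<Rightarrow> 'g set \<Rightarrow> 'g \<Rightarrow> 'g \<Rightarrow> nat" where
  "word_dist G S x y = word_length G S (inv\<^bsub>G\<^esub> x \<otimes>\<^bsub>G\<^esub> y)"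

definition gromov_product :: "('g, 'm) monoid_scheme \<Rightarrow> 'g set \<Rightarrow> 'g \<Rightarrow> 'g \<Rightarrow> 'g \<Rightarrow> real" where
  "gromov_product G S w x y =
     (real (word_dist G S x w) + real (word_dist G S y w) - real (word_dist G S x y)) / 2"

text \<open>
  Gromov's four-point definition, with the constant \<open>\<delta>\<close>, for the vertex set of the Cayley graph.
  Since the vertices embed isometrically, it holds whenever the Cayley graph itself satisfies the
  four-point condition with constant \<open>\<delta>\<close>. It is the normalisation for which triangles with
  \<open>p\<close> ideal vertices are \<open>4(p + 1)\<delta>\<close>-slim when \<open>\<delta> \<ge> 1\<close>.
\<close>

definition delta_hyperbolic :: "('g, 'm) monoid_scheme \<Rightarrow> 'g set \<Rightarrow> real \<Rightarrow> bool" where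
  "delta_hyperbolic G S \<delta> \<longleftrightarrow>
     (\<forall>w\<in>carrier G. \<forall>x\<in>carrier G. \<forall>y\<in>carrier G. \<forall>z\<in>carrier G.
        gromov_product G S w x z \<ge>
          min (gromov_product G S w x y) (gromov_product G S w y z) - \<delta>)"

text \<open>All geodesics needed below have a first point, so their domain is an interval of the
  integers starting at 0: \<open>{..n}\<close> for segments and \<open>UNIV\<close> for rays.\<close>

definition geodesic :: "('g, 'm) monoid_scheme \<Rightarrow> 'g set \<Rightarrow> nat set \<Rightarrow> (nat \<Rightarrow> 'g) \<Rightarrow> bool" where
  "geodesic G S I \<gamma> \<longleftrightarrow>
     (\<forall>i\<in>I. \<gamma> i \<in> carrier G) \<and>
     (\<forall>i\<in>I. \<forall>j\<in>I. int (word_dist G S (\<gamma> i) (\<gamma> j)) = \<bar>int i - int j\<bar>)"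


section \<open>Gromov boundary\<close>

text \<open>
  The boundary is the set of classes of sequences converging to infinity; a boundary point
  is the set of all sequences converging to it.
\<close>

definition products_to_infinity ::
  "('g, 'm) monoid_scheme \<Rightarrow> 'g set \<Rightarrow> (nat \<Rightarrow> 'g) \<Rightarrow> (nat \<Rightarrow> 'g) \<Rightarrow> bool" where
  "products_to_infinity G S x y \<longleftrightarrow>
     filterlim (\<lambda>(i, j). gromov_product G S \<one>\<^bsub>G\<^esub> (x i) (y j)) at_top
       (sequentially \<times>\<^sub>F sequentially)"

definition seqs_to_infinity :: "('g, 'm) monoid_scheme \<Rightarrow> 'g set \<Rightarrow> (nat \<Rightarrow> 'g) set" where
  "seqs_to_infinity G S = {x. range x \<subseteq> carrier G \<and> products_to_infinity G S x x}"

definition boundary :: "('g, 'm) monoid_scheme \<Rightarrow> 'g set \<Rightarrow> (nat \<Rightarrow> 'g) set set" where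
  "boundary G S =
     seqs_to_infinity G S //
       {(x, y). x \<in> seqs_to_infinity G S \<and> y \<in> seqs_to_infinity G S \<and>
                products_to_infinity G S x y}"

definition boundary_action ::
  "('g, 'm) monoid_scheme \<Rightarrow> 'g set \<Rightarrow> 'g \<Rightarrow> (nat \<Rightarrow> 'g) set \<Rightarrow> (nat \<Rightarrow> 'g) set" where
  "boundary_action G S g = (\<lambda>\<xi>\<in>boundary G S. (\<lambda>x n. g \<otimes>\<^bsub>G\<^esub> x n) ` \<xi>)"

definition boundary_product ::
  "('g, 'm) monoid_scheme \<Rightarrow> 'g set \<Rightarrow> (nat \<Rightarrow> 'g) set \<Rightarrow> (nat \<Rightarrow> 'g) set \<Rightarrow> ereal" where
  "boundary_product G S \<xi> \<eta> =
     (SUP x\<in>\<xi>. SUP y\<in>\<eta>.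
        Liminf (sequentially \<times>\<^sub>F sequentially)
          (\<lambda>(i, j). ereal (gromov_product G S \<one>\<^bsub>G\<^esub> (x i) (y j))))"

text \<open>The product of two distinct boundary points is finite, so \<open>real_of_ereal\<close> is harmless.\<close>

definition visual_metric ::
  "('g, 'm) monoid_scheme \<Rightarrow> 'g set \<Rightarrow> ((nat \<Rightarrow> 'g) set \<Rightarrow> (nat \<Rightarrow> 'g) set \<Rightarrow> real) \<Rightarrow> bool" where
  "visual_metric G S \<rho> \<longleftrightarrow>
     Metric_space (boundary G S) \<rho> \<and>
     (\<exists>a>1. \<exists>k\<^sub>1>0. \<exists>k\<^sub>2>0. \<forall>\<xi>\<in>boundary G S. \<forall>\<eta>\<in>boundary G S. \<xi> \<noteq> \<eta> \<longrightarrow>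
        k\<^sub>1 * a powr (- real_of_ereal (boundary_product G S \<xi> \<eta>)) \<le> \<rho> \<xi> \<eta> \<and>
        \<rho> \<xi> \<eta> \<le> k\<^sub>2 * a powr (- real_of_ereal (boundary_product G S \<xi> \<eta>)))"


section \<open>Cone types, ball types, spans and the sets \<open>S\<^sub>g\<close>\<close>

definition cone_type :: "('g, 'm) monoid_scheme \<Rightarrow> 'g set \<Rightarrow> 'g \<Rightarrow> 'g set" where
  "cone_type G S x =
     {y \<in> carrier G. \<exists>n \<gamma>. geodesic G S {..n} \<gamma> \<and> \<gamma> 0 = \<one>\<^bsub>G\<^esub> \<and> \<gamma> n = x \<otimes>\<^bsub>G\<^esub> y \<and> (\<exists>k\<le>n. \<gamma> k = x)}"

definition ball_type :: "('g, 'm) monoid_scheme \<Rightarrow> 'g set \<Rightarrow> nat \<Rightarrow> 'g \<Rightarrow> 'g \<Rightarrow> int" where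
  "ball_type G S N x =
     (\<lambda>y\<in>{y \<in> carrier G. word_length G S y \<le> N}.
        int (word_length G S (x \<otimes>\<^bsub>G\<^esub> y)) - int (word_length G S x))"

definition boundary_span :: "('g, 'm) monoid_scheme \<Rightarrow> 'g set \<Rightarrow> 'g \<Rightarrow> (nat \<Rightarrow> 'g) set set" where
  "boundary_span G S g =
     {\<xi> \<in> boundary G S. \<exists>\<gamma>\<in>\<xi>. geodesic G S UNIV \<gamma> \<and> \<gamma> 0 = \<one>\<^bsub>G\<^esub> \<and> (\<exists>k. \<gamma> k = g)}"

definition span_neighbours :: "('g, 'm) monoid_scheme \<Rightarrow> 'g set \<Rightarrow> 'g \<Rightarrow> 'g set" where
  "span_neighbours G S g =
     {h \<in> carrier G. word_length G S (g \<otimes>\<^bsub>G\<^esub> h) = word_length G S g \<and>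
        boundary_span G S (g \<otimes>\<^bsub>G\<^esub> h) \<inter> boundary_span G S g \<noteq> {}}"

definition S_set ::
  "('g, 'm) monoid_scheme \<Rightarrow> 'g set \<Rightarrow> ((nat \<Rightarrow> 'g) set \<Rightarrow> (nat \<Rightarrow> 'g) set \<Rightarrow> real) \<Rightarrow>
   'g \<Rightarrow> (nat \<Rightarrow> 'g) set set" where
  "S_set G S \<rho> g =
     Metric_space.mtopology (boundary G S) \<rho> interior_of
       (\<Union>h\<in>span_neighbours G S g. boundary_span G S (g \<otimes>\<^bsub>G\<^esub> h))"


section \<open>Quasi-invariant systems of covers\<close>

text \<open>Diameter with values in \<open>[0, \<infinity>]\<close>; the empty set has diameter 0.\<close>

definition ediam :: "('x \<Rightarrow> 'x \<Rightarrow> real) \<Rightarrow> 'x set \<Rightarrow> ennreal" where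
  "ediam \<rho> A = (SUP p\<in>A. SUP q\<in>A. ennreal (\<rho> p q))"

definition acts_by_homeomorphisms ::
  "('g, 'm) monoid_scheme \<Rightarrow> 'x set \<Rightarrow> ('x \<Rightarrow> 'x \<Rightarrow> real) \<Rightarrow> ('g \<Rightarrow> 'x \<Rightarrow> 'x) \<Rightarrow> bool" where
  "acts_by_homeomorphisms G X \<rho> act \<longleftrightarrow>
     Metric_space X \<rho> \<and> group_action G X act \<and>
     (\<forall>g\<in>carrier G.
        homeomorphic_map (Metric_space.mtopology X \<rho>) (Metric_space.mtopology X \<rho>) (act g))"

definition type_function :: "('g, 'm) monoid_scheme \<Rightarrow> ('g \<Rightarrow> 't) \<Rightarrow> bool" where
  "type_function G T \<longleftrightarrow> finite (T ` carrier G)"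

text \<open>
  The maximum over the finite sphere of radius \<open>n\<close> is written as a supremum in \<open>[0, \<infinity>]\<close>, which
  is 0 when the sphere is empty (possible only for finite groups).
\<close>

definition quasi_invariant ::
  "('g, 'm) monoid_scheme \<Rightarrow> 'g set \<Rightarrow> 'x set \<Rightarrow> ('x \<Rightarrow> 'x \<Rightarrow> real) \<Rightarrow> ('g \<Rightarrow> 'x \<Rightarrow> 'x) \<Rightarrow>
   ('g \<Rightarrow> 'x set) \<Rightarrow> ('g \<Rightarrow> 't) \<Rightarrow> bool" where
  "quasi_invariant G S X \<rho> act C T \<longleftrightarrow>
     acts_by_homeomorphisms G X \<rho> act \<and> type_function G T \<and> (\<forall>x\<in>carrier G. C x \<subseteq> X) \<and>
     (\<exists>(D::real)>0. \<exists>(J::nat)>0.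
        ((\<lambda>n. SUP x\<in>{x \<in> carrier G. word_length G S x = n}. ediam \<rho> (C x)) \<longlonglongrightarrow> 0) \<and>
        (\<forall>x\<in>carrier G. \<forall>y\<in>carrier G.
           word_length G S x = word_length G S y \<and> C x \<inter> C y \<noteq> {} \<longrightarrow>
           real (word_dist G S x y) \<le> D) \<and>
        (\<forall>x\<in>carrier G. \<forall>k::nat. 0 < k \<and> real k \<le> real (word_length G S x) / real J \<longrightarrow>
           (\<exists>y\<in>carrier G. int (word_length G S y) = int (word_length G S x) - int k * int J \<and>
                          C x \<subseteq> C y)) \<and>
        (\<forall>g\<in>carrier G. \<forall>x\<in>carrier G. T x = T (g \<otimes>\<^bsub>G\<^esub> x) \<longrightarrow>
           C (g \<otimes>\<^bsub>G\<^esub> x) = act g ` C x \<and>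
           (\<forall>y\<in>carrier G. word_length G S y = word_length G S x \<and> C x \<inter> C y \<noteq> {} \<longrightarrow>
              C (g \<otimes>\<^bsub>G\<^esub> y) = act g ` C y \<and>
              word_length G S (g \<otimes>\<^bsub>G\<^esub> y) = word_length G S (g \<otimes>\<^bsub>G\<^esub> x)) \<and>
           (\<forall>y\<in>carrier G. \<forall>k::nat.
              0 < k \<and> word_length G S y = word_length G S x + k * J \<and> C y \<noteq> {} \<and> C y \<subseteq> C x \<longrightarrow>
              word_length G S (g \<otimes>\<^bsub>G\<^esub> y) = word_length G S (g \<otimes>\<^bsub>G\<^esub> x) + k * J \<and>
              T (g \<otimes>\<^bsub>G\<^esub> y) = T y \<and>
              C (g \<otimes>\<^bsub>G\<^esub> y) = act g ` C y)))"

definition quasi_invariant_system_of_covers ::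
  "('g, 'm) monoid_scheme \<Rightarrow> 'g set \<Rightarrow> 'x set \<Rightarrow> ('x \<Rightarrow> 'x \<Rightarrow> real) \<Rightarrow> ('g \<Rightarrow> 'x \<Rightarrow> 'x) \<Rightarrow>
   ('g \<Rightarrow> 'x set) \<Rightarrow> ('g \<Rightarrow> 't) \<Rightarrow> bool" where
  "quasi_invariant_system_of_covers G S X \<rho> act C T \<longleftrightarrow>
     quasi_invariant G S X \<rho> act C T \<and>
     (\<forall>n. (\<forall>x\<in>carrier G. word_length G S x = n \<longrightarrow>
             openin (Metric_space.mtopology X \<rho>) (C x)) \<and>
          (\<Union>x\<in>{x \<in> carrier G. word_length G S x = n}. C x) = X)"

end

theory Submission
  imports Defs
begin

section \<open>Quasi-invariance of the system of covers\<close>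

text \<open>
  Two geodesic rays from the identity to the same boundary point stay \<open>4\<delta>\<close>-close at equal times,
  so all the spans making up \<open>S_g\<close> are based at points at distance at most \<open>4\<delta>\<close> from \<open>g\<close>. If \<open>x\<close>
  and \<open>gx\<close> share a large ball type, then points \<open>xh\<close> with \<open>h\<close> short have the same cone types as
  \<open>gxh\<close>; since a cone type determines the span, \<open>g\<close> carries the spans near \<open>x\<close> to those near \<open>gx\<close>,
  and being a homeomorphism it carries \<open>S_x\<close> to \<open>S_gx\<close>. For \<open>y\<close> far beyond \<open>x\<close>, every geodesic from the
  identity to a point of the \<open>N\<close>-ball around \<open>y\<close> passes \<open>4\<delta>\<close>-close to a neighbour of \<open>x\<close>, hence
  through a cone that \<open>g\<close> preserves; so \<open>|gz| - |z|\<close> is constant on that ball and the ball type of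
  \<open>y\<close> persists. The sets \<open>S_g\<close> cover because spans are closed, by a limit argument for rays,
  and there are only finitely many for each word length.
\<close>

subsection \<open>Word metric and geodesics\<close>

text \<open>Koenig's lemma by diagonal extraction: the pigeonhole principle makes one coordinate
  after another constant on a decreasing chain of infinite index sets. The limits taken later only
  use that each agreement set is infinite, so no subsequence is extracted.\<close>

lemma koenig:
  fixes p :: "nat \<Rightarrow> nat \<Rightarrow> 'a"
  assumes "\<And>n. finite (range (\<lambda>i. p i n))"
  obtains \<gamma> where "\<And>n. infinite {i. \<forall>m\<le>n. p i m = \<gamma> m}"
proof -
  have step: "\<exists>B. B \<subseteq> A \<and> infinite B \<and> (\<exists>c. \<forall>i\<in>B. p i n = c)" if A: "infinite A" for A n
  proof -
    have "finite ((\<lambda>i. p i n) ` A)"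
      using assms[of n] by (rule finite_subset[rotated]) auto
    then obtain a where "a \<in> A" "infinite {i \<in> A. p i n = p a n}"
      using pigeonhole_infinite[OF A] by blast
    then show ?thesis
      by (intro exI[of _ "{i \<in> A. p i n = p a n}"]) auto
  qed
  have "\<exists>A. \<forall>n. (infinite (A n) \<and> (\<exists>c. \<forall>i\<in>A n. p i n = c)) \<and> A (Suc n) \<subseteq> A n"
  proof (rule dependent_nat_choice)
    show "\<exists>A. infinite A \<and> (\<exists>c. \<forall>i\<in>A. p i 0 = c)"
      using step[of UNIV 0] by auto
    show "\<exists>B. (infinite B \<and> (\<exists>c. \<forall>i\<in>B. p i (Suc n) = c)) \<and> B \<subseteq> A"
      if "infinite A \<and> (\<exists>c. \<forall>i\<in>A. p i n = c)" for A n
      using step[of A "Suc n"] that by blast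
  qed
  then obtain A where inf: "\<And>n. infinite (A n)" and const: "\<And>n. \<exists>c. \<forall>i\<in>A n. p i n = c"
    and sub: "\<And>n. A (Suc n) \<subseteq> A n" by blast
  from const obtain \<gamma> where \<gamma>: "\<And>n i. i \<in> A n \<Longrightarrow> p i n = \<gamma> n" by metis
  have "A n \<subseteq> A m" if "m \<le> n" for m n
    using lift_Suc_antimono_le[of A] sub that by blast
  then have "A n \<subseteq> {i. \<forall>m\<le>n. p i m = \<gamma> m}" for n
    using \<gamma> by blast
  then show thesis
    using inf that by (meson infinite_super)
qed

section \<open>Word length and word distance in a finitely generated group\<close>

locale fin_gen_group = group G for G (structure) +
  fixes S :: "'a set"
  assumes finite_gens: "finite S" and gens_closed: "S \<subseteq> carrier G"
    and generates: "generate G S = carrier G"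
begin

abbreviation len :: "'a \<Rightarrow> nat" where "len \<equiv> word_length G S"

abbreviation wd :: "'a \<Rightarrow> 'a \<Rightarrow> nat" where "wd \<equiv> word_dist G S"

abbreviation letters :: "'a set" where "letters \<equiv> S \<union> m_inv G ` S"

abbreviation eval_word :: "'a list \<Rightarrow> 'a" where "eval_word ws \<equiv> foldr (\<otimes>) ws \<one>"

lemma letters_closed: "letters \<subseteq> carrier G"
  using gens_closed by auto

lemma inv_letters: "a \<in> letters \<Longrightarrow> inv a \<in> letters"
  using gens_closed by auto

lemma eval_word_closed: "set ws \<subseteq> letters \<Longrightarrow> eval_word ws \<in> carrier G"
  using letters_closed by (induction ws) auto

lemma eval_word_append:
  assumes "set us \<subseteq> letters" "set vs \<subseteq> letters"
  shows "eval_word (us @ vs) = eval_word us \<otimes> eval_word vs"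
  using assms
proof (induction us)
  case Nil
  then show ?case using eval_word_closed by simp
next
  case (Cons a us)
  then have "a \<in> carrier G" using letters_closed by auto
  then show ?case using Cons eval_word_closed m_assoc by simp
qed

lemma eval_word_inv:
  assumes "set ws \<subseteq> letters"
  shows "inv (eval_word ws) = eval_word (rev (map (m_inv G) ws))"
  using assms
proof (induction ws)
  case (Cons a ws)
  then have a: "a \<in> carrier G" "a \<in> letters" and ws: "set ws \<subseteq> letters" using letters_closed by auto
  have "set (rev (map (m_inv G) ws)) \<subseteq> letters" using ws inv_letters by fastforce
  moreover have "set [inv a] \<subseteq> letters" using a inv_letters by simp
  ultimately have "eval_word (rev (map (m_inv G) (a # ws))) = eval_word (rev (map (m_inv G) ws)) \<otimes> eval_word [inv a]"
    using eval_word_append by (simp del: foldr_append)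
  then show ?case using Cons ws a eval_word_closed inv_mult_group by simp
qed simp

lemma exists_word:
  assumes "x \<in> carrier G"
  shows "\<exists>ws. set ws \<subseteq> letters \<and> eval_word ws = x"
proof -
  have "x \<in> generate G S" using assms generates by simp
  then show ?thesis
  proof (induction rule: generate.induct)
    case one
    then show ?case by (intro exI[of _ "[]"]) simp
  next
    case (incl h)
    then show ?case using gens_closed by (intro exI[of _ "[h]"]) auto
  next
    case (inv h)
    then show ?case using gens_closed by (intro exI[of _ "[inv h]"]) auto
  next
    case (eng h1 h2)
    then obtain us vs where "set us \<subseteq> letters" "eval_word us = h1" "set vs \<subseteq> letters" "eval_word vs = h2"
      by blast
    then show ?case using eval_word_append by (intro exI[of _ "us @ vs"]) (simp del: foldr_append)
  qed
qed

lemma len_le: "set ws \<subseteq> letters \<Longrightarrow> len (eval_word ws) \<le> length ws"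
  unfolding word_length_def by (rule Least_le) auto

text \<open>The minimum in \<open>word_length\<close> is attained because \<open>S\<close> generates
  the group, so \<open>LEAST\<close> ranges over a nonempty set.\<close>

lemma geodesic_word:
  assumes "x \<in> carrier G"
  obtains ws where "set ws \<subseteq> letters" "eval_word ws = x" "length ws = len x"
proof -
  have "\<exists>n ws. length ws = n \<and> set ws \<subseteq> letters \<and> eval_word ws = x"
    using exists_word[OF assms] by auto
  then have "\<exists>ws. length ws = len x \<and> set ws \<subseteq> letters \<and> eval_word ws = x"
    unfolding word_length_def by (rule LeastI_ex)
  then show thesis using that by blast
qed

lemma len_one [simp]: "len \<one> = 0"
  using len_le[of "[]"] by simp

lemma len_eq_0:
  assumes "x \<in> carrier G" "len x = 0"
  shows "x = \<one>"
  using geodesic_word[OF assms(1)] assms(2) by force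

lemma len_mult_le:
  assumes "x \<in> carrier G" "y \<in> carrier G"
  shows "len (x \<otimes> y) \<le> len x + len y"
proof -
  obtain us where us: "set us \<subseteq> letters" "eval_word us = x" "length us = len x"
    using geodesic_word assms by blast
  obtain vs where vs: "set vs \<subseteq> letters" "eval_word vs = y" "length vs = len y"
    using geodesic_word assms by blast
  show ?thesis
    using len_le[of "us @ vs"] eval_word_append[OF us(1) vs(1)] us vs by (simp del: foldr_append)
qed

lemma len_inv [simp]:
  assumes "x \<in> carrier G"
  shows "len (inv x) = len x"
proof -
  have *: "len (inv y) \<le> len y" if y: "y \<in> carrier G" for y
  proof -
    obtain us where us: "set us \<subseteq> letters" "eval_word us = y" "length us = len y"
      using geodesic_word y by blast
    have "set (rev (map (m_inv G) us)) \<subseteq> letters" using us inv_letters by fastforce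
    then have "len (eval_word (rev (map (m_inv G) us))) \<le> length us"
      using len_le by fastforce
    then show ?thesis unfolding eval_word_inv[OF us(1), symmetric] us(2,3) .
  qed
  show ?thesis using *[of x] *[of "inv x"] assms by simp
qed

lemma finite_ball: "finite {x \<in> carrier G. len x \<le> n}"
proof (rule finite_subset)
  show "finite (eval_word ` {ws. set ws \<subseteq> letters \<and> length ws \<le> n})"
    by (intro finite_imageI finite_lists_length_le) (simp add: finite_gens)
  show "{x \<in> carrier G. len x \<le> n} \<subseteq> eval_word ` {ws. set ws \<subseteq> letters \<and> length ws \<le> n}"
  proof
    fix x assume "x \<in> {x \<in> carrier G. len x \<le> n}"
    then show "x \<in> eval_word ` {ws. set ws \<subseteq> letters \<and> length ws \<le> n}"
      using geodesic_word[of x] by (metis (mono_tags, lifting) image_eqI mem_Collect_eq)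
  qed
qed

lemma wd_one [simp]: "x \<in> carrier G \<Longrightarrow> wd \<one> x = len x"
  by (simp add: word_dist_def)

lemma wd_sym:
  assumes "x \<in> carrier G" "y \<in> carrier G"
  shows "wd x y = wd y x"
proof -
  have "inv x \<otimes> y = inv (inv y \<otimes> x)" using assms by (simp add: inv_mult_group)
  then show ?thesis using assms by (simp add: word_dist_def)
qed

lemma wd_one' [simp]: "x \<in> carrier G \<Longrightarrow> wd x \<one> = len x"
  using wd_sym[of x \<one>] by simp

lemma wd_refl [simp]: "x \<in> carrier G \<Longrightarrow> wd x x = 0"
  by (simp add: word_dist_def)

lemma inv_mult_cancel:
  assumes "x \<in> carrier G" "y \<in> carrier G"
  shows "inv x \<otimes> (x \<otimes> y) = y" "x \<otimes> (inv x \<otimes> y) = y"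
  using assms by (simp_all flip: m_assoc)

lemma wd_mult_left [simp]:
  assumes "g \<in> carrier G" "x \<in> carrier G" "y \<in> carrier G"
  shows "wd (g \<otimes> x) (g \<otimes> y) = wd x y"
proof -
  have "inv (g \<otimes> x) \<otimes> (g \<otimes> y) = inv x \<otimes> y"
    using assms by (simp add: inv_mult_group m_assoc inv_mult_cancel)
  then show ?thesis by (simp add: word_dist_def)
qed

lemma wd_mult [simp]:
  assumes "g \<in> carrier G" "x \<in> carrier G"
  shows "wd g (g \<otimes> x) = len x"
  using assms by (simp add: word_dist_def inv_mult_cancel)

lemma wd_triangle:
  assumes "x \<in> carrier G" "y \<in> carrier G" "z \<in> carrier G"
  shows "wd x z \<le> wd x y + wd y z"
proof -
  have "inv x \<otimes> z = (inv x \<otimes> y) \<otimes> (inv y \<otimes> z)"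
    using assms by (simp add: m_assoc inv_mult_cancel)
  then show ?thesis
    using len_mult_le[of "inv x \<otimes> y" "inv y \<otimes> z"] assms by (simp add: word_dist_def)
qed

lemma len_triangle:
  assumes "x \<in> carrier G" "y \<in> carrier G"
  shows "len y \<le> len x + wd x y"
  using wd_triangle[of \<one> x y] assms by simp

section \<open>Geodesics in the Cayley graph\<close>

lemma geodesicI:
  assumes "\<And>i. i \<in> I \<Longrightarrow> \<gamma> i \<in> carrier G"
    and "\<And>i j. i \<in> I \<Longrightarrow> j \<in> I \<Longrightarrow> i \<le> j \<Longrightarrow> wd (\<gamma> i) (\<gamma> j) = j - i"
  shows "geodesic G S I \<gamma>"
  unfolding geodesic_def
proof (intro conjI ballI)
  show "\<gamma> i \<in> carrier G" if "i \<in> I" for i using assms that by blast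
  show "int (wd (\<gamma> i) (\<gamma> j)) = \<bar>int i - int j\<bar>" if "i \<in> I" "j \<in> I" for i j
  proof (cases "i \<le> j")
    case True
    then show ?thesis using assms(2)[OF that] by simp
  next
    case False
    then show ?thesis using assms(2)[OF that(2,1)] wd_sym assms(1) that by simp
  qed
qed

lemma geodesicD:
  assumes "geodesic G S I \<gamma>" "i \<in> I"
  shows "\<gamma> i \<in> carrier G"
    and "j \<in> I \<Longrightarrow> i \<le> j \<Longrightarrow> wd (\<gamma> i) (\<gamma> j) = j - i"
  using assms unfolding geodesic_def by fastforce+

lemma len_geodesic:
  assumes "geodesic G S I \<gamma>" "\<gamma> 0 = \<one>" "0 \<in> I" "i \<in> I"
  shows "len (\<gamma> i) = i"
  using geodesicD[OF assms(1,3)] geodesicD(1)[OF assms(1,4)] assms by (metis diff_zero le0 wd_one)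

lemma geodesic_mult_left:
  assumes "geodesic G S I \<gamma>" "g \<in> carrier G"
  shows "geodesic G S I (\<lambda>i. g \<otimes> \<gamma> i)"
  using assms unfolding geodesic_def by simp

lemma geodesic_mono: "geodesic G S I \<gamma> \<Longrightarrow> J \<subseteq> I \<Longrightarrow> geodesic G S J \<gamma>"
  unfolding geodesic_def by blast

text \<open>The partial products of a shortest word for \<open>x\<close> form a path from the
  identity to \<open>x\<close> of length \<open>len x\<close>, which admits no shortcut.\<close>

lemma exists_geodesic:
  assumes "x \<in> carrier G"
  obtains \<gamma> where "geodesic G S {..len x} \<gamma>" "\<gamma> 0 = \<one>" "\<gamma> (len x) = x"
proof -
  obtain ws where ws: "set ws \<subseteq> letters" "eval_word ws = x" "length ws = len x"
    using geodesic_word assms by blast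
  define \<gamma> where "\<gamma> i = eval_word (take i ws)" for i
  have sub: "set (take i ws) \<subseteq> letters" "set (drop i (take j ws)) \<subseteq> letters" for i j
    using ws(1) by (meson in_set_dropD in_set_takeD subsetD subsetI)+
  have cl: "\<gamma> i \<in> carrier G" for i
    unfolding \<gamma>_def using eval_word_closed[OF sub(1)] .
  have le: "wd (\<gamma> i) (\<gamma> j) \<le> j - i" if "i \<le> j" "j \<le> len x" for i j
  proof -
    have "take j ws = take i ws @ drop i (take j ws)"
      by (metis append_take_drop_id min.absorb1 take_take that(1))
    then have "\<gamma> j = \<gamma> i \<otimes> eval_word (drop i (take j ws))"
      unfolding \<gamma>_def using eval_word_append[OF sub(1) sub(2)] by metis
    then have "wd (\<gamma> i) (\<gamma> j) = len (eval_word (drop i (take j ws)))"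
      using cl eval_word_closed[OF sub(2)] by simp
    also have "\<dots> \<le> j - i"
      using len_le[OF sub(2)[of i j]] by simp
    finally show ?thesis .
  qed
  have ends: "\<gamma> 0 = \<one>" "\<gamma> (len x) = x"
    using ws by (simp_all add: \<gamma>_def)
  have "geodesic G S {..len x} \<gamma>"
  proof (rule geodesicI)
    fix i j assume ij: "i \<in> {..len x}" "j \<in> {..len x}" "i \<le> j"
    \<comment> \<open>The upper bounds for the three pieces of the path to \<open>x\<close> add up
      to \<open>len x\<close>, so the middle piece cannot be shorter than
      \<open>j - i\<close>.\<close>
    have "len x \<le> len (\<gamma> i) + wd (\<gamma> i) x" using len_triangle cl assms by simp
    moreover have "wd (\<gamma> i) x \<le> wd (\<gamma> i) (\<gamma> j) + wd (\<gamma> j) x" using wd_triangle cl assms by simp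
    moreover have "wd (\<gamma> j) x \<le> len x - j" using le[of j "len x"] ends ij by simp
    moreover have "len (\<gamma> i) \<le> i" using le[of 0 i] ends ij cl by simp
    ultimately show "wd (\<gamma> i) (\<gamma> j) = j - i" using le[of i j] ij by simp
  qed (rule cl)
  then show thesis using ends that by blast
qed

text \<open>A shortcut from \<open>\<beta> i\<close> to \<open>\<alpha> (j - n)\<close> would make
  the latter shorter than \<open>j\<close>, so correct lengths alone make the junction geodesic.
  Leaving \<open>I\<close> free covers segments and rays at once.\<close>

lemma geodesic_concat:
  assumes \<beta>: "geodesic G S {..n} \<beta>" "\<beta> 0 = \<one>" "\<beta> n = \<alpha> 0"
    and \<alpha>: "geodesic G S I \<alpha>" "0 \<in> I" "\<And>k. k \<in> I \<Longrightarrow> len (\<alpha> k) = n + k"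
  shows "geodesic G S {i. i \<le> n \<or> i - n \<in> I} (\<lambda>i. if i \<le> n then \<beta> i else \<alpha> (i - n))"
proof (rule geodesicI)
  have \<beta>c: "\<beta> i \<in> carrier G" "len (\<beta> i) = i" if "i \<le> n" for i
    using geodesicD(1)[OF \<beta>(1)] len_geodesic[OF \<beta>(1,2)] that by auto
  have \<alpha>c: "\<alpha> i \<in> carrier G" if "i \<in> I" for i
    using geodesicD(1)[OF \<alpha>(1)] that by auto
  fix i assume i: "i \<in> {i. i \<le> n \<or> i - n \<in> I}"
  show "(if i \<le> n then \<beta> i else \<alpha> (i - n)) \<in> carrier G" using i \<beta>c \<alpha>c by auto
  fix j assume j: "j \<in> {i. i \<le> n \<or> i - n \<in> I}" and ij: "i \<le> j"
  consider "j \<le> n" | "i \<le> n" "n < j" | "n < i" using ij by linarith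
  then show "wd (if i \<le> n then \<beta> i else \<alpha> (i - n)) (if j \<le> n then \<beta> j else \<alpha> (j - n)) = j - i"
  proof cases
    case 1
    then show ?thesis using geodesicD(2)[OF \<beta>(1), of i j] ij by simp
  next
    case 2
    then have jI: "j - n \<in> I" using j by simp
    have "wd (\<beta> i) (\<alpha> (j - n)) \<le> wd (\<beta> i) (\<beta> n) + wd (\<alpha> 0) (\<alpha> (j - n))"
      using wd_triangle[of "\<beta> i" "\<beta> n" "\<alpha> (j - n)"] \<beta>c \<alpha>c \<alpha>c[OF \<alpha>(2)] \<beta>(3) jI 2 by simp
    moreover have "wd (\<beta> i) (\<beta> n) = n - i" "wd (\<alpha> 0) (\<alpha> (j - n)) = j - n"
      using geodesicD(2)[OF \<beta>(1), of i n] geodesicD(2)[OF \<alpha>(1,2), of "j - n"] jI 2 by auto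
    moreover have "len (\<alpha> (j - n)) \<le> len (\<beta> i) + wd (\<beta> i) (\<alpha> (j - n))"
      using len_triangle[of "\<beta> i" "\<alpha> (j - n)"] \<beta>c \<alpha>c jI 2 by simp
    ultimately show ?thesis using 2 \<alpha>(3)[OF jI] \<beta>c(2)[OF 2(1)] by simp
  next
    case 3
    then show ?thesis using geodesicD(2)[OF \<alpha>(1), of "i - n" "j - n"] ij i j by auto
  qed
qed

section \<open>Cone types and ball types\<close>

lemma cone_type_iff:
  assumes "x \<in> carrier G" "y \<in> carrier G"
  shows "y \<in> cone_type G S x \<longleftrightarrow> len (x \<otimes> y) = len x + len y"
proof
  assume "y \<in> cone_type G S x"
  then obtain n \<gamma> k where *: "geodesic G S {..n} \<gamma>" "\<gamma> 0 = \<one>" "\<gamma> n = x \<otimes> y" "k \<le> n" "\<gamma> k = x"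
    unfolding cone_type_def by auto
  then have "len (x \<otimes> y) = n" "len x = k"
    using len_geodesic[OF *(1,2), of n] len_geodesic[OF *(1,2), of k] by auto
  moreover have "len y = n - k"
    using geodesicD(2)[OF *(1), of k n] * assms by simp
  ultimately show "len (x \<otimes> y) = len x + len y" using * by simp
next
  assume len: "len (x \<otimes> y) = len x + len y"
  obtain \<beta> where \<beta>: "geodesic G S {..len x} \<beta>" "\<beta> 0 = \<one>" "\<beta> (len x) = x"
    using exists_geodesic assms by blast
  obtain \<alpha> where \<alpha>: "geodesic G S {..len y} \<alpha>" "\<alpha> 0 = \<one>" "\<alpha> (len y) = y"
    using exists_geodesic assms by blast
  have \<alpha>c: "\<alpha> k \<in> carrier G" "len (\<alpha> k) = k" if "k \<le> len y" for k
    using geodesicD(1)[OF \<alpha>(1)] len_geodesic[OF \<alpha>(1,2)] that by auto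
  \<comment> \<open>If the intermediate point \<open>x \<otimes> \<alpha> k\<close> were shorter
    than this, so would be \<open>x \<otimes> y\<close>.\<close>
  have "len (x \<otimes> \<alpha> k) = len x + k" if "k \<in> {..len y}" for k
  proof -
    have "len (x \<otimes> \<alpha> k) \<le> len x + k" using len_mult_le[of x "\<alpha> k"] assms \<alpha>c that by simp
    moreover have "len (x \<otimes> y) \<le> len (x \<otimes> \<alpha> k) + wd (x \<otimes> \<alpha> k) (x \<otimes> y)"
      using len_triangle[of "x \<otimes> \<alpha> k" "x \<otimes> y"] assms \<alpha>c that by simp
    moreover have "wd (x \<otimes> \<alpha> k) (x \<otimes> y) = len y - k"
      using geodesicD(2)[OF \<alpha>(1), of k "len y"] assms \<alpha> \<alpha>c that by simp
    ultimately show ?thesis using len that by simp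
  qed
  then have "geodesic G S {i. i \<le> len x \<or> i - len x \<in> {..len y}}
      (\<lambda>i. if i \<le> len x then \<beta> i else x \<otimes> \<alpha> (i - len x))"
    by (intro geodesic_concat \<beta> geodesic_mult_left \<alpha>) (use \<alpha> \<beta> assms in auto)
  moreover have "{i. i \<le> len x \<or> i - len x \<in> {..len y}} = {..len x + len y}" by auto
  ultimately have "geodesic G S {..len x + len y} (\<lambda>i. if i \<le> len x then \<beta> i else x \<otimes> \<alpha> (i - len x))"
    (is "geodesic G S _ ?\<gamma>")
    by simp
  \<comment> \<open>For \<open>len y = 0\<close> the endpoint falls into the \<open>\<beta>\<close>
    branch; then \<open>y\<close> is the identity and the value is still right.\<close>
  moreover have "?\<gamma> 0 = \<one>" "?\<gamma> (len x + len y) = x \<otimes> y" "?\<gamma> (len x) = x"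
    using \<alpha> \<beta> assms len_eq_0[of y] by auto
  ultimately show "y \<in> cone_type G S x"
    unfolding cone_type_def using assms(2) le_add1 by blast
qed

lemma cone_type_dist:
  assumes "x \<in> carrier G" "x' \<in> carrier G" "cone_type G S x = cone_type G S x'"
    and "y \<in> carrier G" "len (x \<otimes> y) = len x + len y"
  shows "len (x' \<otimes> y) = len x' + len y"
  using assms cone_type_iff by metis

lemma ball_type_eq_iff:
  "ball_type G S N x = ball_type G S N x' \<longleftrightarrow>
    (\<forall>y\<in>carrier G. len y \<le> N \<longrightarrow>
       int (len (x \<otimes> y)) - int (len x) = int (len (x' \<otimes> y)) - int (len x'))"
  unfolding ball_type_def by (auto simp: fun_eq_iff restrict_def)

text \<open>The ball of radius \<open>M\<close> about \<open>x \<otimes> h\<close> sits inside the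
  ball of radius \<open>N\<close> about \<open>x\<close>, and length increments from
  \<open>x \<otimes> h\<close> are differences of increments from \<open>x\<close>.\<close>

lemma ball_type_mult:
  assumes "x \<in> carrier G" "x' \<in> carrier G" "h \<in> carrier G"
    and eq: "ball_type G S N x = ball_type G S N x'" and "len h + M \<le> N"
  shows "ball_type G S M (x \<otimes> h) = ball_type G S M (x' \<otimes> h)"
  unfolding ball_type_eq_iff
proof (intro ballI impI)
  fix y assume y: "y \<in> carrier G" "len y \<le> M"
  have "len (h \<otimes> y) \<le> N" using len_mult_le[of h y] assms y by simp
  then have "int (len (x \<otimes> (h \<otimes> y))) - int (len x) = int (len (x' \<otimes> (h \<otimes> y))) - int (len x')"
    using eq assms y unfolding ball_type_eq_iff by blast
  moreover have "int (len (x \<otimes> h)) - int (len x) = int (len (x' \<otimes> h)) - int (len x')"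
    using eq assms unfolding ball_type_eq_iff by auto
  ultimately show "int (len (x \<otimes> h \<otimes> y)) - int (len (x \<otimes> h)) =
      int (len (x' \<otimes> h \<otimes> y)) - int (len (x' \<otimes> h))"
    using assms y by (simp add: m_assoc)
qed

text \<open>By the triangle inequality the values lie between \<open>- int N\<close> and
  \<open>int N\<close>, and a finite ball carries only finitely many extensional functions into this
  interval.\<close>

lemma finite_ball_types: "finite (ball_type G S N ` carrier G)"
proof (rule finite_subset)
  let ?B = "{y \<in> carrier G. len y \<le> N}"
  show "finite (PiE ?B (\<lambda>_. {- int N..int N}))"
    by (intro finite_PiE finite_ball) simp
  show "ball_type G S N ` carrier G \<subseteq> PiE ?B (\<lambda>_. {- int N..int N})"
  proof
    fix f assume "f \<in> ball_type G S N ` carrier G"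
    then obtain x where x: "x \<in> carrier G" and f: "f = ball_type G S N x" by blast
    have "f y \<in> {- int N..int N}" if y: "y \<in> ?B" for y
    proof -
      have "len (x \<otimes> y) \<le> len x + len y" using len_mult_le x y by simp
      moreover have "len x \<le> len (x \<otimes> y) + len y"
        using len_triangle[of "x \<otimes> y" x] wd_sym[of "x \<otimes> y" x] x y by simp
      ultimately show ?thesis using y unfolding f ball_type_def by simp
    qed
    then show "f \<in> PiE ?B (\<lambda>_. {- int N..int N})"
      unfolding f ball_type_def by (auto simp: PiE_def)
  qed
qed

section \<open>Geodesic rays and their limits\<close>

abbreviation ray :: "(nat \<Rightarrow> 'a) \<Rightarrow> bool" where
  "ray \<gamma> \<equiv> geodesic G S UNIV \<gamma> \<and> \<gamma> 0 = \<one>"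

lemma ray_len: "ray \<gamma> \<Longrightarrow> len (\<gamma> i) = i"
  using len_geodesic by blast

lemma ray_concat:
  assumes "geodesic G S {..n} \<beta>" "\<beta> 0 = \<one>" "\<beta> n = \<alpha> 0"
    and "geodesic G S UNIV \<alpha>" "\<And>k. len (\<alpha> k) = n + k"
  shows "ray (\<lambda>i. if i \<le> n then \<beta> i else \<alpha> (i - n))"
  using geodesic_concat[of n \<beta> \<alpha> UNIV] assms by simp

text \<open>The length bound confines the \<open>n\<close>-th points to a finite ball, so Koenig's
  lemma applies. Geodesicity is asked only eventually on each initial segment, which lets segments
  of growing length converge to a ray.\<close>

lemma ray_limit:
  assumes one: "\<And>i. p i 0 = \<one>" and bounded: "\<And>i n. p i n \<in> carrier G \<and> len (p i n) \<le> n"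
    and geod: "\<And>n. eventually (\<lambda>i. geodesic G S {..n} (p i)) sequentially"
  obtains \<gamma> where "ray \<gamma>" "\<And>n. infinite {i. \<forall>m\<le>n. p i m = \<gamma> m}"
proof -
  have "finite (range (\<lambda>i. p i n))" for n
    using bounded by (intro finite_subset[OF _ finite_ball[of n]]) auto
  then obtain \<gamma> where \<gamma>: "\<And>n. infinite {i. \<forall>m\<le>n. p i m = \<gamma> m}"
    using koenig[of p] by blast
  have approx: "\<exists>i. geodesic G S {..n} (p i) \<and> (\<forall>m\<le>n. p i m = \<gamma> m)" for n
    using \<gamma>[of n] geod[of n] unfolding eventually_sequentially infinite_nat_iff_unbounded_le by blast
  have "\<gamma> i \<in> carrier G" for i
    using approx[of i] bounded by (metis order_refl)
  moreover have "wd (\<gamma> i) (\<gamma> j) = j - i" if "i \<le> j" for i j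
    using approx[of j] geodesicD(2)[of "{..j}" _ i j] that by fastforce
  ultimately have "geodesic G S UNIV \<gamma>"
    by (intro geodesicI)
  moreover have "\<gamma> 0 = \<one>" using approx[of 0] one by (metis order_refl)
  ultimately show thesis using \<gamma> that by blast
qed

end

subsection \<open>Gromov products and boundary points\<close>

locale hyperbolic_group = fin_gen_group G S for G (structure) and S +
  fixes \<delta> :: real
  assumes delta_nonneg: "0 \<le> \<delta>" and hyperbolic: "delta_hyperbolic G S \<delta>"
begin

abbreviation gp :: "'a \<Rightarrow> 'a \<Rightarrow> real" where "gp \<equiv> gromov_product G S \<one>"

lemma gp_eq:
  assumes "x \<in> carrier G" "y \<in> carrier G"
  shows "gp x y = (real (len x) + real (len y) - real (wd x y)) / 2"
  using assms by (simp add: gromov_product_def)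

lemma gp_sym: "x \<in> carrier G \<Longrightarrow> y \<in> carrier G \<Longrightarrow> gp x y = gp y x"
  by (simp add: gp_eq wd_sym)

lemma gp_nonneg: "x \<in> carrier G \<Longrightarrow> y \<in> carrier G \<Longrightarrow> 0 \<le> gp x y"
  using wd_triangle[of x \<one> y] by (simp add: gp_eq)

lemma gp_trans:
  assumes "x \<in> carrier G" "y \<in> carrier G" "z \<in> carrier G"
    and "K \<le> gp x y" "K \<le> gp y z"
  shows "K - \<delta> \<le> gp x z"
  using hyperbolic assms unfolding delta_hyperbolic_def by (smt (verit) one_closed)

text \<open>Distances are kept and each of the two lengths drops by at most \<open>len g\<close>;
  after the halving in the product the total loss is \<open>len g\<close>.\<close>

lemma gp_mult_left:
  assumes "g \<in> carrier G" "x \<in> carrier G" "y \<in> carrier G"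
  shows "gp x y - real (len g) \<le> gp (g \<otimes> x) (g \<otimes> y)"
proof -
  have "len z \<le> len (g \<otimes> z) + len g" if "z \<in> carrier G" for z
    using len_mult_le[of "inv g" "g \<otimes> z"] assms that by (simp add: inv_mult_cancel)
  from this[of x] this[of y] show ?thesis
    using assms by (simp add: gp_eq field_simps)
qed

text \<open>Passing two intermediate points loses \<open>2 * \<delta>\<close>, and for points of
  equal length \<open>n\<close> the product is \<open>n\<close> minus half their distance; hence the
  factor 4.\<close>

lemma fellow_travel:
  assumes "u \<in> carrier G" "a \<in> carrier G" "b \<in> carrier G" "w \<in> carrier G"
    and "len u = n" "len w = n" "n \<le> gp u a" "n \<le> gp a b" "n \<le> gp b w"
  shows "wd u w \<le> 4 * \<delta>"
proof -
  have "n - \<delta> \<le> gp u b" using gp_trans assms by blast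
  moreover have "n - \<delta> \<le> gp b w" using assms delta_nonneg by simp
  ultimately have "n - \<delta> - \<delta> \<le> gp u w" using gp_trans assms by blast
  then show ?thesis using assms gp_eq[of u w] by simp
qed

lemma gp_geodesic:
  assumes "geodesic G S I \<gamma>" "\<gamma> 0 = \<one>" "0 \<in> I" "i \<in> I" "j \<in> I" "i \<le> j"
  shows "gp (\<gamma> i) (\<gamma> j) = i"
  using geodesicD[OF assms(1)] len_geodesic[OF assms(1-3)] assms(4-6) by (simp add: gp_eq)

text \<open>A bound along the product filter, with one threshold for both indices. It keeps track of
  explicit constants; \<open>products_to_infinity\<close> is this statement for all
  \<open>K\<close>.\<close>

definition eventually_ge :: "real \<Rightarrow> (nat \<Rightarrow> 'a) \<Rightarrow> (nat \<Rightarrow> 'a) \<Rightarrow> bool" where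
  "eventually_ge K x y \<longleftrightarrow> (\<exists>n. \<forall>i\<ge>n. \<forall>j\<ge>n. K \<le> gp (x i) (y j))"

lemma eventually_ge_sym:
  assumes "range x \<subseteq> carrier G" "range y \<subseteq> carrier G" "eventually_ge K x y"
  shows "eventually_ge K y x"
  using assms gp_sym unfolding eventually_ge_def by (metis rangeI subsetD)

lemma eventually_ge_trans:
  assumes "range x \<subseteq> carrier G" "range y \<subseteq> carrier G" "range z \<subseteq> carrier G"
    and "eventually_ge K x y" "eventually_ge K y z"
  shows "eventually_ge (K - \<delta>) x z"
proof -
  obtain n where n: "\<And>i j. i \<ge> n \<Longrightarrow> j \<ge> n \<Longrightarrow> K \<le> gp (x i) (y j)"
    using assms(4) unfolding eventually_ge_def by blast
  obtain m where m: "\<And>i j. i \<ge> m \<Longrightarrow> j \<ge> m \<Longrightarrow> K \<le> gp (y i) (z j)"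
    using assms(5) unfolding eventually_ge_def by blast
  have "K - \<delta> \<le> gp (x i) (z j)" if "i \<ge> max n m" "j \<ge> max n m" for i j
    using gp_trans[of "x i" "y (max n m)" "z j" K] n[of i "max n m"] m[of "max n m" j] assms that
    by (auto simp: range_subsetD)
  then show ?thesis unfolding eventually_ge_def by blast
qed

lemma eventually_ge_mult_left:
  assumes "range x \<subseteq> carrier G" "range y \<subseteq> carrier G" "g \<in> carrier G" "eventually_ge K x y"
  shows "eventually_ge (K - len g) (\<lambda>n. g \<otimes> x n) (\<lambda>n. g \<otimes> y n)"
proof -
  have "K - len g \<le> gp (g \<otimes> x i) (g \<otimes> y j)" if "K \<le> gp (x i) (y j)" for i j
    using gp_mult_left[OF assms(3), of "x i" "y j"] assms(1,2) that by (auto simp: range_subsetD)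
  then show ?thesis using assms(4) unfolding eventually_ge_def by blast
qed

lemma products_to_infinity_iff: "products_to_infinity G S x y \<longleftrightarrow> (\<forall>K. eventually_ge K x y)"
  unfolding products_to_infinity_def filterlim_at_top eventually_prod_sequentially eventually_ge_def
  by (simp, blast)

lemma products_to_infinity_sym:
  assumes "range x \<subseteq> carrier G" "range y \<subseteq> carrier G" "products_to_infinity G S x y"
  shows "products_to_infinity G S y x"
  using eventually_ge_sym[OF assms(1,2)] assms(3) unfolding products_to_infinity_iff by blast

lemma products_to_infinity_trans:
  assumes "range x \<subseteq> carrier G" "range y \<subseteq> carrier G" "range z \<subseteq> carrier G"
    and "products_to_infinity G S x y" "products_to_infinity G S y z"
  shows "products_to_infinity G S x z"
  unfolding products_to_infinity_iff
proof
  fix K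
  have "eventually_ge (K + \<delta> - \<delta>) x z"
    using eventually_ge_trans[OF assms(1-3)] assms(4,5) unfolding products_to_infinity_iff by blast
  then show "eventually_ge K x z" by simp
qed

section \<open>Boundary points as classes of sequences\<close>

lemma seqs_carrier: "x \<in> seqs_to_infinity G S \<Longrightarrow> range x \<subseteq> carrier G"
  unfolding seqs_to_infinity_def by blast

lemma boundary_iff:
  "\<xi> \<in> boundary G S \<longleftrightarrow>
    (\<exists>x\<in>seqs_to_infinity G S. \<xi> = {y \<in> seqs_to_infinity G S. products_to_infinity G S x y})"
  unfolding boundary_def quotient_def by auto

lemma boundary_seqs: "\<xi> \<in> boundary G S \<Longrightarrow> x \<in> \<xi> \<Longrightarrow> x \<in> seqs_to_infinity G S"
  unfolding boundary_iff by auto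

lemma boundary_carrier: "\<xi> \<in> boundary G S \<Longrightarrow> x \<in> \<xi> \<Longrightarrow> range x \<subseteq> carrier G"
  using boundary_seqs seqs_carrier by blast

text \<open>Any member can serve as representative: by symmetry and transitivity the class of the
  original representative \<open>z\<close> is the class of \<open>x\<close>.\<close>

lemma boundary_mem_iff:
  assumes "\<xi> \<in> boundary G S" "x \<in> \<xi>"
  shows "y \<in> \<xi> \<longleftrightarrow> y \<in> seqs_to_infinity G S \<and> products_to_infinity G S x y"
proof -
  obtain z where z: "z \<in> seqs_to_infinity G S"
    "\<xi> = {y \<in> seqs_to_infinity G S. products_to_infinity G S z y}"
    using assms boundary_iff by blast
  then have x: "x \<in> seqs_to_infinity G S" "products_to_infinity G S z x"
    "products_to_infinity G S x z"
    using assms(2) products_to_infinity_sym seqs_carrier by blast+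
  have "products_to_infinity G S z y \<longleftrightarrow> products_to_infinity G S x y"
    if "y \<in> seqs_to_infinity G S"
    using products_to_infinity_trans[of z x y] products_to_infinity_trans[of x z y]
      seqs_carrier z(1) x that by blast
  then show ?thesis using z(2) by blast
qed

lemma boundary_eqI:
  assumes "\<xi> \<in> boundary G S" "\<eta> \<in> boundary G S" "x \<in> \<xi>" "y \<in> \<eta>" "products_to_infinity G S x y"
  shows "\<xi> = \<eta>"
proof -
  have "y \<in> \<xi>" using assms boundary_mem_iff boundary_seqs by blast
  then show ?thesis using boundary_mem_iff assms by blast
qed

lemma boundary_class:
  assumes "x \<in> seqs_to_infinity G S"
  shows "{y \<in> seqs_to_infinity G S. products_to_infinity G S x y} \<in> boundary G S"
    and "x \<in> {y \<in> seqs_to_infinity G S. products_to_infinity G S x y}"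
  using assms unfolding boundary_iff by (auto simp: seqs_to_infinity_def)

lemma boundary_nonempty: "\<xi> \<in> boundary G S \<Longrightarrow> \<exists>x. x \<in> \<xi>"
  using boundary_iff boundary_class by blast

lemma boundary_eventually_ge:
  "\<xi> \<in> boundary G S \<Longrightarrow> x \<in> \<xi> \<Longrightarrow> y \<in> \<xi> \<Longrightarrow> eventually_ge K x y"
  using boundary_mem_iff products_to_infinity_iff by blast

text \<open>Convergence ignores finite prefixes and index shifts. This places spliced rays in the
  class of the sequence whose tail they share.\<close>

lemma boundary_shift:
  assumes "\<xi> \<in> boundary G S" "x \<in> \<xi>" "range y \<subseteq> carrier G" "\<And>i. y (i + a) = x (i + b)"
  shows "y \<in> \<xi>"
proof -
  have y: "y j = x (j - a + b)" if "a \<le> j" for j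
    using assms(4)[of "j - a"] that by simp
  have ge: "\<exists>n. \<forall>i\<ge>n. \<forall>j\<ge>n. K \<le> gp (x i) (x j)" for K
    using boundary_eventually_ge[OF assms(1,2,2)] unfolding eventually_ge_def .
  have "eventually_ge K x y \<and> eventually_ge K y y" for K
  proof -
    obtain n where n: "\<forall>i\<ge>n. \<forall>j\<ge>n. K \<le> gp (x i) (x j)" using ge by blast
    then show ?thesis
      unfolding eventually_ge_def by (intro conjI exI[of _ "n + a"]) (auto simp: y)
  qed
  then show ?thesis
    using boundary_mem_iff[OF assms(1,2)] assms(3)
    by (simp add: seqs_to_infinity_def products_to_infinity_iff)
qed

section \<open>Gromov product of boundary points\<close>

lemma boundary_product_ge:
  assumes "x \<in> \<xi>" "y \<in> \<eta>" "eventually_ge K x y"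
  shows "ereal K \<le> boundary_product G S \<xi> \<eta>"
proof -
  have "eventually (\<lambda>(i, j). ereal K \<le> ereal (gp (x i) (y j))) (sequentially \<times>\<^sub>F sequentially)"
    using assms(3) unfolding eventually_ge_def eventually_prod_sequentially by auto
  then have "ereal K \<le> Liminf (sequentially \<times>\<^sub>F sequentially) (\<lambda>(i, j). ereal (gp (x i) (y j)))"
    by (intro Liminf_bounded) (simp add: case_prod_unfold)
  then show ?thesis
    unfolding boundary_product_def using assms(1,2) by (meson SUP_upper2)
qed

text \<open>Some pair of representatives realises the bound \<open>K\<close>; replacing each of the
  two by the given sequence costs \<open>\<delta>\<close>.\<close>

lemma boundary_product_gtD:
  assumes "\<xi> \<in> boundary G S" "\<eta> \<in> boundary G S" "x \<in> \<xi>" "y \<in> \<eta>"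
    and "ereal K < boundary_product G S \<xi> \<eta>"
  shows "eventually_ge (K - 2 * \<delta>) x y"
proof -
  obtain x' y' where x': "x' \<in> \<xi>" and y': "y' \<in> \<eta>"
    and "ereal K < Liminf (sequentially \<times>\<^sub>F sequentially) (\<lambda>(i, j). ereal (gp (x' i) (y' j)))"
    using assms(5) unfolding boundary_product_def less_SUP_iff by blast
  then have "eventually (\<lambda>(i, j). ereal K < ereal (gp (x' i) (y' j))) (sequentially \<times>\<^sub>F sequentially)"
    using less_LiminfD by (fastforce simp: case_prod_unfold)
  then have "eventually_ge K x' y'"
    unfolding eventually_ge_def eventually_prod_sequentially by (auto intro: less_imp_le)
  note K = this
  have carrier: "range x \<subseteq> carrier G" "range x' \<subseteq> carrier G" "range y \<subseteq> carrier G" "range y' \<subseteq> carrier G"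
    using boundary_carrier assms(1-4) x' y' by blast+
  have "eventually_ge (K - \<delta>) x y'"
    by (rule eventually_ge_trans[OF carrier(1,2,4) boundary_eventually_ge[OF assms(1,3) x'] K])
  then have "eventually_ge (K - \<delta> - \<delta>) x y"
    by (rule eventually_ge_trans[OF carrier(1,4,3) _ boundary_eventually_ge[OF assms(2) y' assms(4)]])
  then show ?thesis by (simp add: algebra_simps)
qed

text \<open>An infinite product would identify the two points, and products in the group are
  nonnegative.\<close>

lemma boundary_product_finite:
  assumes "\<xi> \<in> boundary G S" "\<eta> \<in> boundary G S" "\<xi> \<noteq> \<eta>"
  shows "boundary_product G S \<xi> \<eta> = ereal (real_of_ereal (boundary_product G S \<xi> \<eta>))"
proof -
  obtain x y where xy: "x \<in> \<xi>" "y \<in> \<eta>" using assms boundary_nonempty by meson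
  have "boundary_product G S \<xi> \<eta> \<noteq> \<infinity>"
  proof
    assume inf: "boundary_product G S \<xi> \<eta> = \<infinity>"
    have "eventually_ge (K + 2 * \<delta> - 2 * \<delta>) x y" for K
      using inf by (intro boundary_product_gtD[OF assms(1,2) xy]) simp
    then have "products_to_infinity G S x y" unfolding products_to_infinity_iff by simp
    then show False using boundary_eqI assms xy by blast
  qed
  moreover have "eventually_ge 0 x y"
    using gp_nonneg boundary_carrier[OF assms(1) xy(1)] boundary_carrier[OF assms(2) xy(2)]
    unfolding eventually_ge_def by (auto simp: range_subsetD)
  then have "boundary_product G S \<xi> \<eta> \<noteq> - \<infinity>"
    using boundary_product_ge[OF xy] by fastforce
  ultimately show ?thesis by (cases "boundary_product G S \<xi> \<eta>") auto
qed

section \<open>Rays from the identity to boundary points\<close>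

lemma ray_in_seqs:
  assumes "ray \<gamma>"
  shows "\<gamma> \<in> seqs_to_infinity G S"
proof -
  have "eventually_ge K \<gamma> \<gamma>" for K
  proof -
    obtain n :: nat where n: "K \<le> n" using real_arch_simple by blast
    have "K \<le> gp (\<gamma> i) (\<gamma> j)" if "i \<ge> n" "j \<ge> n" for i j
      using gp_geodesic[of UNIV \<gamma> i j] gp_geodesic[of UNIV \<gamma> j i] assms n that
        gp_sym[of "\<gamma> i" "\<gamma> j"] geodesicD(1)[of UNIV \<gamma>]
      by (cases "i \<le> j") auto
    then show ?thesis unfolding eventually_ge_def by blast
  qed
  then show ?thesis
    using assms geodesicD(1) unfolding seqs_to_infinity_def products_to_infinity_iff by blast
qed

lemma ray_carrier: "ray \<gamma> \<Longrightarrow> \<gamma> i \<in> carrier G"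
  using geodesicD(1) by blast

text \<open>Go out along one ray, across to the other where their product is at least
  \<open>n\<close>, and back: these are the three links of \<open>fellow_travel\<close>.\<close>

lemma rays_fellow_travel:
  assumes "\<xi> \<in> boundary G S" "\<gamma> \<in> \<xi>" "\<gamma>' \<in> \<xi>" "ray \<gamma>" "ray \<gamma>'"
  shows "wd (\<gamma> n) (\<gamma>' n) \<le> 4 * \<delta>"
proof -
  obtain m where m: "\<And>i j. i \<ge> m \<Longrightarrow> j \<ge> m \<Longrightarrow> n \<le> gp (\<gamma> i) (\<gamma>' j)"
    using boundary_eventually_ge[OF assms(1-3)] unfolding eventually_ge_def by blast
  define k where "k = max m n"
  have "n \<le> gp (\<gamma> n) (\<gamma> k)" "n \<le> gp (\<gamma>' k) (\<gamma>' n)"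
    using gp_geodesic[of UNIV \<gamma> n k] gp_geodesic[of UNIV \<gamma>' n k] assms
      gp_sym[of "\<gamma>' n" "\<gamma>' k"] ray_carrier[OF assms(5)] by (auto simp: k_def)
  then show ?thesis
    using fellow_travel[of "\<gamma> n" "\<gamma> k" "\<gamma>' k" "\<gamma>' n" n] m[of k k]
      ray_carrier assms ray_len by (auto simp: k_def)
qed

text \<open>The ray is a limit of geodesic segments from the identity to the points of a sequence in
  \<open>\<xi>\<close>.\<close>

lemma ray_to_boundary_point:
  assumes \<xi>: "\<xi> \<in> boundary G S"
  obtains \<gamma> where "\<gamma> \<in> \<xi>" "ray \<gamma>"
proof -
  obtain x where x: "x \<in> \<xi>" using boundary_nonempty \<xi> by blast
  then have xc: "x i \<in> carrier G" for i using boundary_carrier \<xi> by blast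
  have ge: "\<exists>n. \<forall>i\<ge>n. \<forall>j\<ge>n. K \<le> gp (x i) (x j)" for K
    using boundary_eventually_ge[OF \<xi> x x] unfolding eventually_ge_def .
  have "\<exists>\<alpha>. geodesic G S {..len (x i)} \<alpha> \<and> \<alpha> 0 = \<one> \<and> \<alpha> (len (x i)) = x i" for i
    using exists_geodesic[OF xc] by metis
  then obtain \<alpha> where \<alpha>: "\<And>i. geodesic G S {..len (x i)} (\<alpha> i)" "\<And>i. \<alpha> i 0 = \<one>"
    "\<And>i. \<alpha> i (len (x i)) = x i" by metis
  \<comment> \<open>Past its endpoint each segment stays constant, which gives a total function that
    still satisfies \<open>len (p i n) \<le> n\<close>.\<close>
  define p where "p i n = \<alpha> i (min n (len (x i)))" for i n
  have long: "\<exists>m. \<forall>i\<ge>m. n \<le> len (x i)" for n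
  proof -
    have "gp (x i) (x i) = len (x i)" for i using gp_eq[OF xc xc, of i i] xc by simp
    then show ?thesis using ge[of "real n"] by (metis of_nat_le_iff)
  qed
  obtain \<gamma> where \<gamma>: "ray \<gamma>" "\<And>n. infinite {i. \<forall>m\<le>n. p i m = \<gamma> m}"
  proof (rule ray_limit[of p])
    show "p i 0 = \<one>" for i using \<alpha> by (simp add: p_def)
    show "p i n \<in> carrier G \<and> len (p i n) \<le> n" for i n
      using geodesicD(1)[OF \<alpha>(1)] len_geodesic[OF \<alpha>(1,2)] by (simp add: p_def)
    show "eventually (\<lambda>i. geodesic G S {..n} (p i)) sequentially" for n
    proof -
      have "geodesic G S {..n} (p i)" if "n \<le> len (x i)" for i
      proof -
        have "geodesic G S {..n} (\<alpha> i)" using geodesic_mono[OF \<alpha>(1)] that by simp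
        moreover have "\<forall>k\<in>{..n}. p i k = \<alpha> i k" using that by (simp add: p_def)
        ultimately show ?thesis by (simp add: geodesic_def)
      qed
      then show ?thesis using long[of n] unfolding eventually_sequentially by blast
    qed
  qed blast
  have "eventually_ge K x \<gamma>" for K
  proof -
    obtain n where n: "\<And>i j. i \<ge> n \<Longrightarrow> j \<ge> n \<Longrightarrow> K + \<delta> \<le> gp (x i) (x j)" using ge by blast
    obtain m :: nat where m: "K + \<delta> \<le> m" using real_arch_simple by blast
    have "K \<le> gp (x i) (\<gamma> j)" if i: "i \<ge> n" and j: "j \<ge> m" for i j
    proof -
      obtain l where l: "\<forall>i\<ge>l. j \<le> len (x i)" using long by blast
      \<comment> \<open>For such a \<open>k\<close> the product of \<open>x i\<close> and
        \<open>x k\<close> is large and the segment to \<open>x k\<close> passes through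
        \<open>\<gamma> j\<close>. So \<open>x k\<close> links \<open>x i\<close> to
        \<open>\<gamma> j\<close>, at the cost of the \<open>\<delta>\<close> added to
        \<open>K\<close>.\<close>
      obtain k where k: "k \<ge> max n l" "\<And>m. m \<le> j \<Longrightarrow> p k m = \<gamma> m"
        using \<gamma>(2)[of j] unfolding infinite_nat_iff_unbounded_le by blast
      then have "\<alpha> k j = \<gamma> j" using l k(2)[of j] by (simp add: p_def)
      then have "gp (\<gamma> j) (x k) = j"
        using gp_geodesic[OF \<alpha>(1,2), of k j "len (x k)"] \<alpha>(3) l k(1) by simp
      then have "K + \<delta> \<le> gp (x k) (\<gamma> j)"
        using m j gp_sym[OF xc ray_carrier[OF \<gamma>(1)]] by simp
      then show ?thesis
        using gp_trans[OF xc xc ray_carrier[OF \<gamma>(1)], of "K + \<delta>" i k j] n[OF i, of k] k(1) by simp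
    qed
    then show ?thesis unfolding eventually_ge_def by (intro exI[of _ "max n m"]) simp
  qed
  then have "\<gamma> \<in> \<xi>"
    using boundary_mem_iff[OF \<xi> x] ray_in_seqs[OF \<gamma>(1)] products_to_infinity_iff by blast
  then show thesis using that \<gamma>(1) by blast
qed

subsection \<open>Spans and the boundary action\<close>

abbreviation span :: "'a \<Rightarrow> (nat \<Rightarrow> 'a) set set" where "span \<equiv> boundary_span G S"

abbreviation act :: "'a \<Rightarrow> (nat \<Rightarrow> 'a) set \<Rightarrow> (nat \<Rightarrow> 'a) set" where "act \<equiv> boundary_action G S"

lemma span_boundary: "span g \<subseteq> boundary G S"
  unfolding boundary_span_def by blast

lemma spanE:
  assumes "\<xi> \<in> span g"
  obtains \<gamma> where "\<xi> \<in> boundary G S" "\<gamma> \<in> \<xi>" "ray \<gamma>" "\<gamma> (len g) = g"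
proof -
  obtain \<gamma> k where \<gamma>: "\<xi> \<in> boundary G S" "\<gamma> \<in> \<xi>" "ray \<gamma>" "\<gamma> k = g"
    using assms unfolding boundary_span_def by blast
  then show thesis using that ray_len by metis
qed

lemma spanI: "\<xi> \<in> boundary G S \<Longrightarrow> \<gamma> \<in> \<xi> \<Longrightarrow> ray \<gamma> \<Longrightarrow> \<xi> \<in> span (\<gamma> k)"
  unfolding boundary_span_def by blast

lemma span_carrier: "\<xi> \<in> span g \<Longrightarrow> g \<in> carrier G"
  using spanE ray_carrier by metis

text \<open>Swapping the start of a ray through \<open>g\<close> for any other geodesic to
  \<open>g\<close> yields a ray with the same tail, hence with the same limit.\<close>

lemma span_prefix:
  assumes "\<xi> \<in> span g" "geodesic G S {..len g} \<beta>" "\<beta> 0 = \<one>" "\<beta> (len g) = g" "i \<le> len g"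
  shows "\<xi> \<in> span (\<beta> i)"
proof -
  obtain \<gamma> where \<gamma>: "\<xi> \<in> boundary G S" "\<gamma> \<in> \<xi>" "ray \<gamma>" "\<gamma> (len g) = g"
    using spanE assms(1) by blast
  let ?\<gamma> = "\<lambda>i. if i \<le> len g then \<beta> i else \<gamma> (len g + (i - len g))"
  have "geodesic G S UNIV (\<lambda>k. \<gamma> (len g + k))"
    using \<gamma>(3) unfolding geodesic_def by simp
  then have ray: "ray ?\<gamma>"
    using ray_concat[of "len g" \<beta> "\<lambda>k. \<gamma> (len g + k)"] assms \<gamma> ray_len by simp
  have "?\<gamma> \<in> \<xi>"
  proof (rule boundary_shift[OF \<gamma>(1,2)])
    show "range ?\<gamma> \<subseteq> carrier G" using ray_carrier[OF ray] by blast
    \<comment> \<open>At \<open>i = 0\<close> the value still comes from \<open>\<beta>\<close>; it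
      agrees because both curves are at \<open>g\<close> there.\<close>
    show "?\<gamma> (i + len g) = \<gamma> (i + len g)" for i
      using assms(4) \<gamma>(4) by (cases "i = 0") (simp_all add: add.commute)
  qed
  then show ?thesis using spanI[OF \<gamma>(1) _ ray, of i] assms(5) by simp
qed

lemma span_dist:
  assumes "\<xi> \<in> span g" "\<xi> \<in> span h" "len g = len h"
  shows "wd g h \<le> 4 * \<delta>"
proof -
  obtain \<gamma> where \<gamma>: "\<xi> \<in> boundary G S" "\<gamma> \<in> \<xi>" "ray \<gamma>" "\<gamma> (len g) = g"
    using spanE assms(1) by blast
  obtain \<gamma>' where \<gamma>': "\<gamma>' \<in> \<xi>" "ray \<gamma>'" "\<gamma>' (len h) = h"
    using spanE assms(2) by blast
  show ?thesis using rays_fellow_travel[OF \<gamma>(1,2) \<gamma>'(1) \<gamma>(3) \<gamma>'(2), of "len g"] \<gamma> \<gamma>' assms(3) by simp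
qed

section \<open>Translation action on the boundary\<close>

lemma products_to_infinity_mult_left:
  assumes "range x \<subseteq> carrier G" "range y \<subseteq> carrier G" "g \<in> carrier G"
    and "products_to_infinity G S x y"
  shows "products_to_infinity G S (\<lambda>n. g \<otimes> x n) (\<lambda>n. g \<otimes> y n)"
  unfolding products_to_infinity_iff
proof
  fix K :: real
  have "eventually_ge (K + len g) x y"
    using assms(4) unfolding products_to_infinity_iff by blast
  from eventually_ge_mult_left[OF assms(1-3) this]
  show "eventually_ge K (\<lambda>n. g \<otimes> x n) (\<lambda>n. g \<otimes> y n)" by simp
qed

lemma seqs_mult_left:
  assumes "x \<in> seqs_to_infinity G S" "g \<in> carrier G"
  shows "(\<lambda>n. g \<otimes> x n) \<in> seqs_to_infinity G S"
  using products_to_infinity_mult_left[of x x g] assms unfolding seqs_to_infinity_def by auto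

lemma act_boundary:
  assumes \<xi>: "\<xi> \<in> boundary G S" and g: "g \<in> carrier G"
  shows "act g \<xi> \<in> boundary G S"
proof -
  obtain x where x: "x \<in> \<xi>" using boundary_nonempty \<xi> by blast
  then have xs: "x \<in> seqs_to_infinity G S" using boundary_seqs \<xi> by blast
  let ?gx = "\<lambda>n. g \<otimes> x n"
  have "act g \<xi> = {y \<in> seqs_to_infinity G S. products_to_infinity G S ?gx y}"
  proof (intro equalityI subsetI)
    fix y assume "y \<in> act g \<xi>"
    then obtain z where z: "z \<in> \<xi>" "y = (\<lambda>n. g \<otimes> z n)"
      using \<xi> by (auto simp: boundary_action_def)
    then show "y \<in> {y \<in> seqs_to_infinity G S. products_to_infinity G S ?gx y}"
      using products_to_infinity_mult_left[of x z g] seqs_mult_left[of z g] boundary_mem_iff[OF \<xi> x]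
        seqs_carrier xs g by blast
  next
    fix y assume y: "y \<in> {y \<in> seqs_to_infinity G S. products_to_infinity G S ?gx y}"
    then have yc: "y n \<in> carrier G" for n using seqs_carrier by blast
    have xc: "x n \<in> carrier G" for n using seqs_carrier xs by blast
    \<comment> \<open>The image of \<open>\<xi>\<close> is a full class: any sequence equivalent to
      \<open>?gx\<close> is pulled back by \<open>inv g\<close> to a member of
      \<open>\<xi>\<close>.\<close>
    let ?z = "\<lambda>n. inv g \<otimes> y n"
    have "products_to_infinity G S (\<lambda>n. inv g \<otimes> ?gx n) ?z"
      using y g seqs_carrier seqs_mult_left[OF xs g] by (intro products_to_infinity_mult_left) auto
    then have "products_to_infinity G S x ?z"
      using xc g by (simp add: inv_mult_cancel)
    then have "?z \<in> \<xi>"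
      using boundary_mem_iff[OF \<xi> x] seqs_mult_left[of y "inv g"] y g by simp
    moreover have "y = (\<lambda>n. g \<otimes> ?z n)" using yc g by (simp add: inv_mult_cancel)
    ultimately show "y \<in> act g \<xi>" using \<xi> by (auto simp: boundary_action_def)
  qed
  then show ?thesis using boundary_class(1)[OF seqs_mult_left[OF xs g]] by simp
qed

lemma act_mem: "\<xi> \<in> boundary G S \<Longrightarrow> x \<in> \<xi> \<Longrightarrow> (\<lambda>n. g \<otimes> x n) \<in> act g \<xi>"
  by (auto simp: boundary_action_def)

lemma boundary_eq_mem: "\<xi> \<in> boundary G S \<Longrightarrow> \<eta> \<in> boundary G S \<Longrightarrow> x \<in> \<xi> \<Longrightarrow> x \<in> \<eta> \<Longrightarrow> \<xi> = \<eta>"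
  using boundary_eqI boundary_mem_iff by blast

lemma act_act:
  assumes "\<xi> \<in> boundary G S" "g \<in> carrier G" "h \<in> carrier G"
  shows "act g (act h \<xi>) = act (g \<otimes> h) \<xi>"
proof -
  obtain x where x: "x \<in> \<xi>" using boundary_nonempty assms by blast
  then have "range x \<subseteq> carrier G" using boundary_carrier assms by blast
  then have "(\<lambda>n. (g \<otimes> h) \<otimes> x n) = (\<lambda>n. g \<otimes> (h \<otimes> x n))"
    using assms by (auto simp: m_assoc range_subsetD)
  then have "(\<lambda>n. g \<otimes> (h \<otimes> x n)) \<in> act (g \<otimes> h) \<xi>"
    using act_mem[OF assms(1) x, of "g \<otimes> h"] by simp
  moreover have "(\<lambda>n. g \<otimes> (h \<otimes> x n)) \<in> act g (act h \<xi>)"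
    using act_mem[OF act_boundary[OF assms(1,3)] act_mem[OF assms(1) x]] .
  ultimately show ?thesis using boundary_eq_mem act_boundary assms by (meson m_closed)
qed

lemma act_one:
  assumes "\<xi> \<in> boundary G S"
  shows "act \<one> \<xi> = \<xi>"
proof -
  obtain x where x: "x \<in> \<xi>" using boundary_nonempty assms by blast
  then have "range x \<subseteq> carrier G" using boundary_carrier assms by blast
  then have "(\<lambda>n. \<one> \<otimes> x n) = x" by (auto simp: range_subsetD)
  then show ?thesis using boundary_eq_mem act_boundary act_mem[OF assms x, of \<one>] assms x by (metis one_closed)
qed

lemma act_inv:
  assumes "\<xi> \<in> boundary G S" "g \<in> carrier G"
  shows "act (inv g) (act g \<xi>) = \<xi>" "act g (act (inv g) \<xi>) = \<xi>"
  using assms act_act act_one by simp_all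

lemma group_action_boundary: "group_action G (boundary G S) act"
proof -
  have Bij: "act g \<in> Bij (boundary G S)" if "g \<in> carrier G" for g
  proof -
    have "bij_betw (act g) (boundary G S) (boundary G S)"
      using act_boundary act_inv that
      by (intro bij_betw_byWitness[where f' = "act (inv g)"]) auto
    then show ?thesis unfolding Bij_def boundary_action_def by simp
  qed
  have "act (g \<otimes> h) = compose (boundary G S) (act g) (act h)"
    if "g \<in> carrier G" "h \<in> carrier G" for g h
  proof
    fix \<xi>
    show "act (g \<otimes> h) \<xi> = compose (boundary G S) (act g) (act h) \<xi>"
      using act_act[of \<xi> g h] that by (cases "\<xi> \<in> boundary G S") (auto simp: compose_def boundary_action_def)
  qed
  then have "act \<in> hom G (BijGroup (boundary G S))"
    using Bij by (auto simp: hom_def BijGroup_def)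
  then show ?thesis
    unfolding group_action_def group_hom_def group_hom_axioms_def
    using group_BijGroup is_group by blast
qed

text \<open>Beyond \<open>x\<close> the points of a ray are \<open>x\<close> times elements of the
  cone type of \<open>x\<close>. With equal cone types the translated tail gains one unit of length
  per step, so a geodesic to \<open>g \<otimes> x\<close> followed by this tail is a ray.\<close>

lemma act_span_subset:
  assumes "g \<in> carrier G" "x \<in> carrier G" "cone_type G S x = cone_type G S (g \<otimes> x)" "\<xi> \<in> span x"
  shows "act g \<xi> \<in> span (g \<otimes> x)"
proof -
  obtain \<gamma> where \<gamma>: "\<xi> \<in> boundary G S" "\<gamma> \<in> \<xi>" "ray \<gamma>" "\<gamma> (len x) = x"
    using spanE assms(4) by blast
  define \<alpha> where "\<alpha> k = g \<otimes> \<gamma> (len x + k)" for k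
  have "geodesic G S UNIV (\<lambda>k. \<gamma> (len x + k))"
    using \<gamma>(3) unfolding geodesic_def by simp
  then have \<alpha>: "geodesic G S UNIV \<alpha>"
    unfolding \<alpha>_def by (rule geodesic_mult_left) (rule assms)
  have len: "len (\<alpha> k) = len (g \<otimes> x) + k" for k
  proof -
    let ?y = "inv x \<otimes> \<gamma> (len x + k)"
    have y: "?y \<in> carrier G" "\<gamma> (len x + k) = x \<otimes> ?y"
      using ray_carrier[OF \<gamma>(3)] assms(2) by (simp_all add: inv_mult_cancel)
    have "len ?y = k"
      using geodesicD(2)[of UNIV \<gamma> "len x" "len x + k"] \<gamma>(3,4) by (simp add: word_dist_def)
    then have "len (g \<otimes> x \<otimes> ?y) = len (g \<otimes> x) + k"
      using cone_type_dist[of x "g \<otimes> x" ?y] assms y ray_len[OF \<gamma>(3), of "len x + k"] by simp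
    then show ?thesis using y assms m_assoc unfolding \<alpha>_def by simp
  qed
  obtain \<beta> where \<beta>: "geodesic G S {..len (g \<otimes> x)} \<beta>" "\<beta> 0 = \<one>" "\<beta> (len (g \<otimes> x)) = g \<otimes> x"
    using exists_geodesic assms by blast
  let ?\<gamma> = "\<lambda>i. if i \<le> len (g \<otimes> x) then \<beta> i else \<alpha> (i - len (g \<otimes> x))"
  have ray: "ray ?\<gamma>"
    using ray_concat[OF \<beta>(1,2) _ \<alpha> len] \<beta>(3) \<gamma>(4) by (simp add: \<alpha>_def)
  have "?\<gamma> \<in> act g \<xi>"
  proof (rule boundary_shift[OF act_boundary[OF \<gamma>(1) assms(1)] act_mem[OF \<gamma>(1,2)]])
    show "range ?\<gamma> \<subseteq> carrier G" using ray_carrier[OF ray] by blast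
    show "?\<gamma> (i + len (g \<otimes> x)) = g \<otimes> \<gamma> (i + len x)" for i
      using \<beta>(3) \<gamma>(4) by (auto simp: \<alpha>_def add.commute)
  qed
  from spanI[OF act_boundary[OF \<gamma>(1) assms(1)] this ray, of "len (g \<otimes> x)"] show ?thesis
    using \<beta>(3) by simp
qed

lemma act_span:
  assumes "g \<in> carrier G" "x \<in> carrier G" "cone_type G S x = cone_type G S (g \<otimes> x)"
  shows "span (g \<otimes> x) = act g ` span x"
proof
  show "act g ` span x \<subseteq> span (g \<otimes> x)" using act_span_subset assms by blast
  show "span (g \<otimes> x) \<subseteq> act g ` span x"
  proof
    fix \<xi> assume \<xi>: "\<xi> \<in> span (g \<otimes> x)"
    then have "act (inv g) \<xi> \<in> span x"
      using act_span_subset[of "inv g" "g \<otimes> x" \<xi>] assms by (simp add: inv_mult_cancel)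
    moreover have "\<xi> = act g (act (inv g) \<xi>)"
      using act_inv(2) \<xi> span_boundary assms by (metis subsetD)
    ultimately show "\<xi> \<in> act g ` span x" by blast
  qed
qed

text \<open>The union whose interior is \<open>S_set\<close>. Estimates are made for this union and
  passed to interiors afterwards.\<close>

definition span_nbhd :: "'a \<Rightarrow> (nat \<Rightarrow> 'a) set set" where
  "span_nbhd g = (\<Union>h\<in>span_neighbours G S g. span (g \<otimes> h))"

lemma span_neighbours_len:
  assumes "g \<in> carrier G" "h \<in> span_neighbours G S g"
  shows "h \<in> carrier G" "len (g \<otimes> h) = len g" "len h \<le> 4 * \<delta>"
proof -
  show *: "h \<in> carrier G" "len (g \<otimes> h) = len g" using assms unfolding span_neighbours_def by auto
  obtain \<xi> where "\<xi> \<in> span (g \<otimes> h)" "\<xi> \<in> span g" using assms unfolding span_neighbours_def by blast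
  then show "len h \<le> 4 * \<delta>" using span_dist[of \<xi> g "g \<otimes> h"] * assms by simp
qed

text \<open>Neighbours are given here by position \<open>g'\<close> instead of displacement
  \<open>h\<close>; membership of \<open>g'\<close> in the group follows from its nonempty
  span.\<close>

lemma span_nbhd_iff:
  assumes "g \<in> carrier G"
  shows "\<xi> \<in> span_nbhd g \<longleftrightarrow> (\<exists>g'. len g' = len g \<and> span g' \<inter> span g \<noteq> {} \<and> \<xi> \<in> span g')"
proof
  assume "\<xi> \<in> span_nbhd g"
  then show "\<exists>g'. len g' = len g \<and> span g' \<inter> span g \<noteq> {} \<and> \<xi> \<in> span g'"
    unfolding span_nbhd_def span_neighbours_def by blast
next
  assume "\<exists>g'. len g' = len g \<and> span g' \<inter> span g \<noteq> {} \<and> \<xi> \<in> span g'"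
  then obtain g' where g': "len g' = len g" "span g' \<inter> span g \<noteq> {}" "\<xi> \<in> span g'" by blast
  have "g' \<in> carrier G" using span_carrier g' by blast
  then have "inv g \<otimes> g' \<in> span_neighbours G S g" "g' = g \<otimes> (inv g \<otimes> g')"
    using g' assms by (simp_all add: span_neighbours_def inv_mult_cancel)
  then show "\<xi> \<in> span_nbhd g" using g'(3) unfolding span_nbhd_def by force
qed

lemma span_nbhd_boundary: "span_nbhd g \<subseteq> boundary G S"
  using span_boundary unfolding span_nbhd_def by blast

text \<open>The chain \<open>x\<close>, \<open>x'\<close>, \<open>y'\<close>, \<open>y\<close> has
  three links, each between points of equal length whose spans meet.\<close>

lemma span_nbhd_dist:
  assumes "x \<in> carrier G" "y \<in> carrier G" "\<xi> \<in> span_nbhd x" "\<xi> \<in> span_nbhd y" "len x = len y"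
  shows "wd x y \<le> 12 * \<delta>"
proof -
  obtain x' \<eta> where x': "len x' = len x" "\<eta> \<in> span x'" "\<eta> \<in> span x" "\<xi> \<in> span x'"
    using assms span_nbhd_iff by blast
  obtain y' \<zeta> where y': "len y' = len y" "\<zeta> \<in> span y'" "\<zeta> \<in> span y" "\<xi> \<in> span y'"
    using assms span_nbhd_iff by blast
  have "wd x x' \<le> 4 * \<delta>" "wd x' y' \<le> 4 * \<delta>" "wd y' y \<le> 4 * \<delta>"
    using span_dist x' y' assms by metis+
  moreover have "x' \<in> carrier G" "y' \<in> carrier G" using span_carrier x' y' by blast+
  ultimately show ?thesis
    using wd_triangle[of x x' y] wd_triangle[of x' y' y] assms by simp
qed

text \<open>The ancestor is the point at distance \<open>n\<close> on a geodesic to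
  \<open>x\<close>. Cutting a ray through a neighbour \<open>x'\<close> at the same distance gives a
  neighbour of the ancestor, since the common point of the spans of \<open>x\<close> and
  \<open>x'\<close> stays in the spans of both cut points.\<close>

lemma span_nbhd_ancestor:
  assumes "x \<in> carrier G" "n \<le> len x"
  shows "\<exists>y\<in>carrier G. len y = n \<and> span_nbhd x \<subseteq> span_nbhd y"
proof -
  obtain \<beta> where \<beta>: "geodesic G S {..len x} \<beta>" "\<beta> 0 = \<one>" "\<beta> (len x) = x"
    using exists_geodesic assms by blast
  have y: "\<beta> n \<in> carrier G" "len (\<beta> n) = n"
    using geodesicD(1)[OF \<beta>(1)] len_geodesic[OF \<beta>(1,2)] assms by auto
  have "\<xi> \<in> span_nbhd (\<beta> n)" if \<xi>: "\<xi> \<in> span_nbhd x" for \<xi>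
  proof -
    obtain x' \<eta> where x': "len x' = len x" "\<eta> \<in> span x'" "\<eta> \<in> span x" "\<xi> \<in> span x'"
      using \<xi> assms span_nbhd_iff by blast
    obtain \<gamma> where \<gamma>: "ray \<gamma>" "\<gamma> (len x') = x'" using spanE x' by blast
    \<comment> \<open>One ray through \<open>x'\<close> serves both \<open>\<xi>\<close> and
      \<open>\<eta>\<close>, as \<open>span_prefix\<close> accepts any geodesic to
      \<open>x'\<close>.\<close>
    have "geodesic G S {..len x'} \<gamma>" using \<gamma> geodesic_mono by blast
    then have "\<xi> \<in> span (\<gamma> n)" "\<eta> \<in> span (\<gamma> n)" "\<eta> \<in> span (\<beta> n)"
      using span_prefix[of \<xi> x' \<gamma> n] span_prefix[of \<eta> x' \<gamma> n] span_prefix[of \<eta> x \<beta> n] x' \<gamma> \<beta> assms by simp_all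
    then show ?thesis
      unfolding span_nbhd_iff[OF y(1)] using ray_len[OF \<gamma>(1), of n] y(2)
      by (intro exI[of _ "\<gamma> n"]) auto
  qed
  then show ?thesis using y by blast
qed

end

subsection \<open>Persistence of ball types\<close>

locale ball_cone_group = hyperbolic_group G S \<delta> for G (structure) and S and \<delta> +
  fixes N\<^sub>0 :: nat
  assumes ball_type_imp_cone_type:
    "\<And>M x y. N\<^sub>0 \<le> M \<Longrightarrow> x \<in> carrier G \<Longrightarrow> y \<in> carrier G \<Longrightarrow>
       ball_type G S M x = ball_type G S M y \<Longrightarrow> cone_type G S x = cone_type G S y"
begin

text \<open>The ball of radius \<open>N\<^sub>0\<close> about \<open>x \<otimes> h\<close> fits into
  the ball of radius \<open>M\<close> about \<open>x\<close>, so \<open>g\<close> preserves the cone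
  type at \<open>x \<otimes> h\<close> and therefore carries its span.\<close>

lemma translate_neighbour:
  assumes "g \<in> carrier G" "x \<in> carrier G" "h \<in> carrier G"
    and "ball_type G S M x = ball_type G S M (g \<otimes> x)" "len h + N\<^sub>0 \<le> M"
  shows "cone_type G S (x \<otimes> h) = cone_type G S (g \<otimes> (x \<otimes> h))"
    and "len (g \<otimes> (x \<otimes> h)) + len x = len (g \<otimes> x) + len (x \<otimes> h)"
    and "span (g \<otimes> (x \<otimes> h)) = act g ` span (x \<otimes> h)"
proof -
  have "ball_type G S N\<^sub>0 (x \<otimes> h) = ball_type G S N\<^sub>0 (g \<otimes> x \<otimes> h)"
    using ball_type_mult assms by blast
  then show *: "cone_type G S (x \<otimes> h) = cone_type G S (g \<otimes> (x \<otimes> h))"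
    using ball_type_imp_cone_type[of N\<^sub>0] assms m_assoc by simp
  show "span (g \<otimes> (x \<otimes> h)) = act g ` span (x \<otimes> h)"
    using act_span[OF _ _ *] assms by simp
  have "int (len (x \<otimes> h)) - int (len x) = int (len (g \<otimes> x \<otimes> h)) - int (len (g \<otimes> x))"
    using assms unfolding ball_type_eq_iff by auto
  then show "len (g \<otimes> (x \<otimes> h)) + len x = len (g \<otimes> x) + len (x \<otimes> h)"
    using assms m_assoc by simp
qed

text \<open>A common point of \<open>span x\<close> and a neighbouring span goes to a common point
  of the translated spans, so neighbours go to neighbours. The extra \<open>4 * \<delta>\<close> in
  the radius is room for the displacement \<open>h\<close>.\<close>

lemma act_span_nbhd_subset:
  assumes "g \<in> carrier G" "x \<in> carrier G" "ball_type G S M x = ball_type G S M (g \<otimes> x)"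
    and "N\<^sub>0 + 4 * \<delta> \<le> M"
  shows "act g ` span_nbhd x \<subseteq> span_nbhd (g \<otimes> x)"
proof
  fix \<zeta> assume "\<zeta> \<in> act g ` span_nbhd x"
  then obtain \<xi> h where h: "h \<in> span_neighbours G S x" "\<xi> \<in> span (x \<otimes> h)" "\<zeta> = act g \<xi>"
    unfolding span_nbhd_def by blast
  obtain \<eta> where \<eta>: "\<eta> \<in> span (x \<otimes> h)" "\<eta> \<in> span x" using h unfolding span_neighbours_def by blast
  note hl = span_neighbours_len[OF assms(2) h(1)]
  have M: "len h + N\<^sub>0 \<le> M" using hl(3) assms(4) by linarith
  note tr = translate_neighbour[OF assms(1,2) hl(1) assms(3) M]
  have "act g \<eta> \<in> span (g \<otimes> x)"
    using translate_neighbour(3)[OF assms(1,2) one_closed assms(3)] \<eta> M assms(2) by simp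
  moreover have "act g \<eta> \<in> span (g \<otimes> (x \<otimes> h))" "\<zeta> \<in> span (g \<otimes> (x \<otimes> h))"
    using tr(3) \<eta> h by auto
  moreover have "len (g \<otimes> (x \<otimes> h)) = len (g \<otimes> x)" using tr(2) hl(2) by simp
  ultimately show "\<zeta> \<in> span_nbhd (g \<otimes> x)"
    using span_nbhd_iff[of "g \<otimes> x"] assms by blast
qed

lemma act_span_nbhd:
  assumes "g \<in> carrier G" "x \<in> carrier G" "ball_type G S M x = ball_type G S M (g \<otimes> x)"
    and "N\<^sub>0 + 4 * \<delta> \<le> M"
  shows "span_nbhd (g \<otimes> x) = act g ` span_nbhd x"
proof
  show "act g ` span_nbhd x \<subseteq> span_nbhd (g \<otimes> x)" using act_span_nbhd_subset assms by blast
  show "span_nbhd (g \<otimes> x) \<subseteq> act g ` span_nbhd x"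
  proof
    fix \<xi> assume \<xi>: "\<xi> \<in> span_nbhd (g \<otimes> x)"
    have "act (inv g) ` span_nbhd (g \<otimes> x) \<subseteq> span_nbhd x"
      using act_span_nbhd_subset[of "inv g" "g \<otimes> x" M] assms by (simp add: inv_mult_cancel)
    moreover have "\<xi> = act g (act (inv g) \<xi>)"
      using act_inv(2) \<xi> span_nbhd_boundary assms by (metis subsetD)
    ultimately show "\<xi> \<in> act g ` span_nbhd x" using \<xi> by blast
  qed
qed

text \<open>A geodesic to \<open>z\<close> passes, at distance \<open>len w\<close>, within \<open>4\<delta>\<close> of \<open>w\<close>, through a point whose
  cone type is preserved by \<open>g\<close>.\<close>

lemma len_translate_beyond:
  assumes "g \<in> carrier G" "w \<in> carrier G" "ball_type G S M w = ball_type G S M (g \<otimes> w)"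
    and "N\<^sub>0 + 4 * \<delta> \<le> M"
    and y: "y \<in> carrier G" "len y = len w + wd w y" and z: "z \<in> carrier G" "wd y z \<le> wd w y"
  shows "len (g \<otimes> z) + len w = len (g \<otimes> w) + len z"
proof -
  \<comment> \<open>As \<open>z\<close> is no farther from \<open>y\<close> than \<open>w\<close>
    is, it is at least as long as \<open>w\<close>, so a geodesic to \<open>z\<close> has a point at
    distance \<open>len w\<close>.\<close>
  have ytri: "len y \<le> len z + wd y z" using len_triangle[of z y] y z wd_sym by simp
  then have nz: "len w \<le> len z" using y z by simp
  obtain \<alpha> where \<alpha>: "geodesic G S {..len z} \<alpha>" "\<alpha> 0 = \<one>" "\<alpha> (len z) = z"
    using exists_geodesic z by blast
  define u where "u = \<alpha> (len w)"
  have u: "u \<in> carrier G" "len u = len w" "wd u z = len z - len w"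
    using geodesicD(1)[OF \<alpha>(1), of "len w"] len_geodesic[OF \<alpha>(1,2), of "len w"]
      geodesicD(2)[OF \<alpha>(1), of "len w" "len z"] \<alpha>(3) nz unfolding u_def by auto
  \<comment> \<open>In the chain \<open>u\<close>, \<open>z\<close>, \<open>y\<close>,
    \<open>w\<close> the outer products equal \<open>len w\<close>, since \<open>u\<close> lies on a
    geodesic to \<open>z\<close> and \<open>w\<close> on one to \<open>y\<close>; the middle product
    is at least \<open>len y - wd y z\<close>.\<close>
  have "wd u w \<le> 4 * \<delta>"
  proof (rule fellow_travel[of u z y w "len w"])
    show "len w \<le> gp u z" using u nz z by (simp add: gp_eq)
    show "len w \<le> gp z y" using ytri y z wd_sym[of z y] by (simp add: gp_eq)
    show "len w \<le> gp y w" using y assms wd_sym[of y w] by (simp add: gp_eq)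
  qed (use u y z assms in auto)
  moreover define h where "h = inv w \<otimes> u"
  ultimately have h: "h \<in> carrier G" "u = w \<otimes> h" "len h \<le> 4 * \<delta>"
    using u assms wd_sym[of u w] by (simp_all add: inv_mult_cancel word_dist_def)
  then have "len h + N\<^sub>0 \<le> M" using assms(4) by linarith
  note tr = translate_neighbour[OF assms(1,2) h(1) assms(3) this, folded h(2)]
  let ?c = "inv u \<otimes> z"
  have c: "?c \<in> carrier G" "z = u \<otimes> ?c" "len ?c = len z - len w"
    using u z by (simp_all add: inv_mult_cancel word_dist_def)
  then have "len (g \<otimes> u \<otimes> ?c) = len (g \<otimes> u) + len ?c"
    using cone_type_dist[OF u(1) _ tr(1) c(1)] u nz assms by simp
  moreover have "g \<otimes> u \<otimes> ?c = g \<otimes> z" using c u assms m_assoc by metis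
  ultimately show ?thesis using tr(2) c(3) nz u(2) by simp
qed

text \<open>It suffices that \<open>len (g \<otimes> z) - len z\<close>, read as an integer, is
  constant on the \<open>N\<close>-ball about \<open>y\<close>. Take a neighbour \<open>w\<close> of
  \<open>x\<close> with \<open>\<xi>\<close> in its span and the point \<open>y'\<close> of length
  \<open>len y\<close> on a ray through \<open>w\<close> to \<open>\<xi>\<close>. It is
  \<open>8 * \<delta>\<close>-close to \<open>y\<close>, so by
  \<open>N + 8 * \<delta> \<le> m\<close> the whole ball is within \<open>wd w y'\<close> of
  \<open>y'\<close>, where \<open>len_translate_beyond\<close> applies.\<close>

lemma ball_type_translate_descendant:
  assumes g: "g \<in> carrier G" and x: "x \<in> carrier G" and y: "y \<in> carrier G"
    and eq: "ball_type G S N x = ball_type G S N (g \<otimes> x)" and N: "N\<^sub>0 + 8 * \<delta> \<le> N"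
    and len: "len y = len x + m" and m: "N + 8 * \<delta> \<le> m"
    and \<xi>: "\<xi> \<in> span_nbhd x" "\<xi> \<in> span_nbhd y"
  shows "len (g \<otimes> y) = len (g \<otimes> x) + m" "ball_type G S N (g \<otimes> y) = ball_type G S N y"
proof -
  obtain h where h: "h \<in> span_neighbours G S x" "\<xi> \<in> span (x \<otimes> h)"
    using \<xi> unfolding span_nbhd_def by blast
  note hl = span_neighbours_len[OF x h(1)]
  define w where "w = x \<otimes> h"
  have w: "w \<in> carrier G" "len w = len x" using hl x by (simp_all add: w_def)
  \<comment> \<open>Moving from \<open>x\<close> to \<open>w\<close> costs at most
    \<open>4 * \<delta>\<close> of the radius and leaves the \<open>N\<^sub>0 + 4 * \<delta>\<close>
    that \<open>len_translate_beyond\<close> asks for.\<close>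
  have "len h + (N - len h) \<le> N" and M: "N\<^sub>0 + 4 * \<delta> \<le> real (N - len h)"
    using hl(3) N delta_nonneg by linarith+
  then have eqw: "ball_type G S (N - len h) w = ball_type G S (N - len h) (g \<otimes> w)"
    using ball_type_mult[of x "g \<otimes> x" h N "N - len h"] g x hl(1) eq by (simp add: w_def m_assoc)
  have lenw: "len (g \<otimes> w) = len (g \<otimes> x)"
    using translate_neighbour(2)[OF g x hl(1) eq] hl(2) hl(3) N delta_nonneg unfolding w_def by simp
  obtain \<gamma> where \<gamma>: "\<xi> \<in> boundary G S" "\<gamma> \<in> \<xi>" "ray \<gamma>" "\<gamma> (len w) = w"
    using spanE h(2) unfolding w_def by blast
  define y' where "y' = \<gamma> (len y)"
  have y': "y' \<in> carrier G" "len y' = len w + wd w y'" "wd w y' = m"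
    using ray_carrier[OF \<gamma>(3)] ray_len[OF \<gamma>(3)] geodesicD(2)[of UNIV \<gamma> "len w" "len y"] \<gamma>(3,4) len w
    unfolding y'_def by auto
  have yy': "wd y' y \<le> 8 * \<delta>"
  proof -
    \<comment> \<open>An intermediate point: the spans of \<open>y'\<close> and \<open>v\<close>
      share \<open>\<xi>\<close>, those of \<open>v\<close> and \<open>y\<close> share
      \<open>\<eta>\<close>.\<close>
    obtain v \<eta> where v: "len v = len y" "\<eta> \<in> span v" "\<eta> \<in> span y" "\<xi> \<in> span v"
      using \<xi> y span_nbhd_iff by blast
    have "len y' = len v" using v w y' len by simp
    then have "wd y' v \<le> 4 * \<delta>"
      using span_dist[of \<xi> y' v] spanI[OF \<gamma>(1-3), of "len y"] v by (simp add: y'_def)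
    moreover have "wd v y \<le> 4 * \<delta>" using span_dist v by blast
    ultimately show ?thesis using wd_triangle[of y' v y] y' y span_carrier[OF v(2)] by simp
  qed
  have *: "len (g \<otimes> z) + len x = len (g \<otimes> x) + len z" if z: "z \<in> carrier G" "wd y z \<le> N" for z
  proof -
    have "wd y' z \<le> wd w y'" using wd_triangle[of y' y z] yy' y y' z m by simp
    then show ?thesis using len_translate_beyond[OF g w(1) eqw M y'(1,2) z(1)] lenw w by simp
  qed
  show **: "len (g \<otimes> y) = len (g \<otimes> x) + m" using *[of y] y len by simp
  show "ball_type G S N (g \<otimes> y) = ball_type G S N y"
    unfolding ball_type_eq_iff
  proof (intro ballI impI)
    fix t assume t: "t \<in> carrier G" "len t \<le> N"
    then show "int (len (g \<otimes> y \<otimes> t)) - int (len (g \<otimes> y)) = int (len (y \<otimes> t)) - int (len y)"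
      using *[of "y \<otimes> t"] ** y g len by (simp add: m_assoc)
  qed
qed

end

subsection \<open>Visual metric\<close>

locale visual_hyperbolic_group = hyperbolic_group G S \<delta> for G (structure) and S and \<delta> +
  fixes \<rho> :: "(nat \<Rightarrow> 'a) set \<Rightarrow> (nat \<Rightarrow> 'a) set \<Rightarrow> real"
  assumes visual: "visual_metric G S \<rho>"
begin

sublocale bd: Metric_space "boundary G S" \<rho>
  using visual by (simp add: visual_metric_def)

text \<open>Together with its converse \<open>small_distD\<close> this translates between the visual
  metric and Gromov products of arbitrary representatives; later metric estimates go through these
  two.\<close>

lemma small_dist:
  assumes "\<epsilon> > 0"
  obtains K where "\<And>\<xi> \<eta> x y. \<xi> \<in> boundary G S \<Longrightarrow> \<eta> \<in> boundary G S \<Longrightarrow> x \<in> \<xi> \<Longrightarrow> y \<in> \<eta> \<Longrightarrow>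
    eventually_ge K x y \<Longrightarrow> \<rho> \<xi> \<eta> < \<epsilon>"
proof -
  obtain a k\<^sub>2 where a: "a > 1" "k\<^sub>2 > 0"
    "\<And>\<xi> \<eta>. \<xi> \<in> boundary G S \<Longrightarrow> \<eta> \<in> boundary G S \<Longrightarrow> \<xi> \<noteq> \<eta> \<Longrightarrow>
      \<rho> \<xi> \<eta> \<le> k\<^sub>2 * a powr (- real_of_ereal (boundary_product G S \<xi> \<eta>))"
    using visual unfolding visual_metric_def by blast
  \<comment> \<open>The summand 1 makes \<open>k\<^sub>2 * a powr (- K)\<close> equal to
    \<open>\<epsilon> / a\<close>, strictly below \<open>\<epsilon>\<close>.\<close>
  define K where "K = log a (k\<^sub>2 / \<epsilon>) + 1"
  have "a powr K = k\<^sub>2 / \<epsilon> * a"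
    using a assms by (simp add: K_def powr_add)
  then have "k\<^sub>2 * a powr (- K) = \<epsilon> / a"
    using a assms by (simp add: powr_minus field_simps)
  also have "\<epsilon> / a < \<epsilon>"
    using a(1) assms by (simp add: divide_less_eq)
  finally have K: "k\<^sub>2 * a powr (- K) < \<epsilon>" .
  have "\<rho> \<xi> \<eta> < \<epsilon>" if \<xi>: "\<xi> \<in> boundary G S" "\<eta> \<in> boundary G S" "x \<in> \<xi>" "y \<in> \<eta>"
    and ge: "eventually_ge K x y" for \<xi> \<eta> x y
  proof (cases "\<xi> = \<eta>")
    case True
    then show ?thesis using bd.mdist_zero \<xi> assms by simp
  next
    case False
    have "K \<le> real_of_ereal (boundary_product G S \<xi> \<eta>)"
      using boundary_product_ge[OF \<xi>(3,4) ge] boundary_product_finite[OF \<xi>(1,2) False]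
      by (metis ereal_less_eq(3))
    then have "k\<^sub>2 * a powr (- real_of_ereal (boundary_product G S \<xi> \<eta>)) \<le> k\<^sub>2 * a powr (- K)"
      using a by simp
    then show ?thesis using a(3)[OF \<xi>(1,2) False] K by linarith
  qed
  then show thesis using that by blast
qed

lemma small_distD:
  obtains r where "r > 0" "\<And>\<xi> \<eta> x y. \<xi> \<in> boundary G S \<Longrightarrow> \<eta> \<in> boundary G S \<Longrightarrow> x \<in> \<xi> \<Longrightarrow> y \<in> \<eta> \<Longrightarrow>
    \<rho> \<xi> \<eta> < r \<Longrightarrow> eventually_ge K x y"
proof -
  obtain a k\<^sub>1 where a: "a > 1" "k\<^sub>1 > 0"
    "\<And>\<xi> \<eta>. \<xi> \<in> boundary G S \<Longrightarrow> \<eta> \<in> boundary G S \<Longrightarrow> \<xi> \<noteq> \<eta> \<Longrightarrow>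
      k\<^sub>1 * a powr (- real_of_ereal (boundary_product G S \<xi> \<eta>)) \<le> \<rho> \<xi> \<eta>"
    using visual unfolding visual_metric_def by blast
  \<comment> \<open>The \<open>2 * \<delta>\<close> pays for passing to arbitrary representatives in
    \<open>boundary_product_gtD\<close>.\<close>
  define r where "r = k\<^sub>1 * a powr (- (K + 2 * \<delta>))"
  have "eventually_ge K x y" if \<xi>: "\<xi> \<in> boundary G S" "\<eta> \<in> boundary G S" "x \<in> \<xi>" "y \<in> \<eta>"
    and less: "\<rho> \<xi> \<eta> < r" for \<xi> \<eta> x y
  proof (cases "\<xi> = \<eta>")
    case True
    then show ?thesis using boundary_eventually_ge \<xi> by blast
  next
    case False
    have "k\<^sub>1 * a powr (- real_of_ereal (boundary_product G S \<xi> \<eta>)) < k\<^sub>1 * a powr (- (K + 2 * \<delta>))"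
      using a(3)[OF \<xi>(1,2) False] less unfolding r_def by linarith
    then have "K + 2 * \<delta> < real_of_ereal (boundary_product G S \<xi> \<eta>)"
      using a by simp
    then have "ereal (K + 2 * \<delta>) < boundary_product G S \<xi> \<eta>"
      using boundary_product_finite[OF \<xi>(1,2) False] by (metis less_ereal.simps(1))
    from boundary_product_gtD[OF \<xi> this] show ?thesis by simp
  qed
  moreover have "r > 0" using a by (simp add: r_def)
  ultimately show thesis using that by blast
qed

text \<open>Translation by \<open>g\<close> lowers products by at most \<open>len g\<close>, so
  asking for \<open>K + len g\<close> beforehand leaves \<open>K\<close> afterwards.\<close>

lemma continuous_map_act:
  assumes g: "g \<in> carrier G"
  shows "continuous_map bd.mtopology bd.mtopology (act g)"
  unfolding bd.metric_continuous_map[OF bd.Metric_space_axioms]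
proof (intro conjI ballI allI impI)
  show "act g ` boundary G S \<subseteq> boundary G S" using act_boundary g by blast
  fix \<xi> and \<epsilon> :: real assume \<xi>: "\<xi> \<in> boundary G S" and "\<epsilon> > 0"
  then obtain K where K: "\<And>\<xi> \<eta> x y. \<xi> \<in> boundary G S \<Longrightarrow> \<eta> \<in> boundary G S \<Longrightarrow> x \<in> \<xi> \<Longrightarrow> y \<in> \<eta> \<Longrightarrow>
      eventually_ge K x y \<Longrightarrow> \<rho> \<xi> \<eta> < \<epsilon>"
    using small_dist by metis
  obtain r where r: "r > 0" "\<And>\<xi> \<eta> x y. \<xi> \<in> boundary G S \<Longrightarrow> \<eta> \<in> boundary G S \<Longrightarrow> x \<in> \<xi> \<Longrightarrow> y \<in> \<eta> \<Longrightarrow>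
      \<rho> \<xi> \<eta> < r \<Longrightarrow> eventually_ge (K + real (len g)) x y"
    using small_distD[of "K + real (len g)"] by metis
  have "\<rho> (act g \<xi>) (act g \<eta>) < \<epsilon>" if \<eta>: "\<eta> \<in> boundary G S" "\<rho> \<xi> \<eta> < r" for \<eta>
  proof -
    obtain x y where xy: "x \<in> \<xi>" "y \<in> \<eta>" using boundary_nonempty \<xi> \<eta> by meson
    have "eventually_ge (K + real (len g)) x y" using r(2) \<xi> \<eta> xy by blast
    from eventually_ge_mult_left[OF boundary_carrier[OF \<xi> xy(1)] boundary_carrier[OF \<eta>(1) xy(2)] g this]
    have "eventually_ge K (\<lambda>n. g \<otimes> x n) (\<lambda>n. g \<otimes> y n)" by simp
    then show ?thesis
      using K[OF act_boundary[OF \<xi> g] act_boundary[OF \<eta>(1) g] act_mem[OF \<xi> xy(1)] act_mem[OF \<eta>(1) xy(2)]]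
      by blast
  qed
  then show "\<exists>r>0. \<forall>\<eta>. \<eta> \<in> boundary G S \<and> \<rho> \<xi> \<eta> < r \<longrightarrow> \<rho> (act g \<xi>) (act g \<eta>) < \<epsilon>"
    using r(1) by blast
qed

lemma homeomorphic_map_act:
  assumes g: "g \<in> carrier G"
  shows "homeomorphic_map bd.mtopology bd.mtopology (act g)"
proof -
  have "homeomorphic_maps bd.mtopology bd.mtopology (act g) (act (inv g))"
    unfolding homeomorphic_maps_def using continuous_map_act act_inv g by simp
  then show ?thesis unfolding homeomorphic_map_maps by blast
qed

lemma acts_by_homeomorphisms_boundary: "acts_by_homeomorphisms G (boundary G S) \<rho> act"
  unfolding acts_by_homeomorphisms_def
  using bd.Metric_space_axioms group_action_boundary homeomorphic_map_act by blast

text \<open>If points of \<open>span g\<close> approach \<open>\<xi>\<close>, their rays through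
  \<open>g\<close> have a limit ray; it still passes through \<open>g\<close>, and it converges to
  \<open>\<xi>\<close>.\<close>

lemma closedin_span:
  assumes "g \<in> carrier G"
  shows "closedin bd.mtopology (span g)"
  unfolding bd.closedin_metric
proof (intro conjI allI impI span_boundary)
  fix \<xi> assume \<xi>: "\<xi> \<in> boundary G S - span g"
  show "\<exists>r>0. disjnt (span g) (bd.mball \<xi> r)"
  proof (rule ccontr)
    assume "\<not> ?thesis"
    then have "\<exists>\<eta>. \<eta> \<in> span g \<and> \<rho> \<xi> \<eta> < inverse (Suc i)" for i
      unfolding disjnt_def by (auto simp: disjoint_iff dest!: spec[of _ "inverse (real (Suc i))"])
    then obtain \<eta> where \<eta>: "\<And>i. \<eta> i \<in> span g" "\<And>i. \<rho> \<xi> (\<eta> i) < inverse (real (Suc i))" by metis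
    then have "\<exists>\<alpha>. \<eta> i \<in> boundary G S \<and> \<alpha> \<in> \<eta> i \<and> ray \<alpha> \<and> \<alpha> (len g) = g" for i
      using spanE by metis
    then obtain \<alpha> where \<alpha>: "\<And>i. \<eta> i \<in> boundary G S" "\<And>i. \<alpha> i \<in> \<eta> i" "\<And>i. ray (\<alpha> i)" "\<And>i. \<alpha> i (len g) = g"
      by metis
    obtain \<gamma> where \<gamma>: "ray \<gamma>" "\<And>n. infinite {i. \<forall>m\<le>n. \<alpha> i m = \<gamma> m}"
    proof (rule ray_limit[of \<alpha>])
      show "\<alpha> i 0 = \<one>" for i using \<alpha>(3) by blast
      show "\<alpha> i n \<in> carrier G \<and> len (\<alpha> i n) \<le> n" for i n
        using ray_carrier[OF \<alpha>(3)] ray_len[OF \<alpha>(3)] by simp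
      show "eventually (\<lambda>i. geodesic G S {..n} (\<alpha> i)) sequentially" for n
        using \<alpha>(3) geodesic_mono by (intro always_eventually) blast
    qed blast
    have g: "\<gamma> (len g) = g"
    proof -
      obtain i where "\<forall>m\<le>len g. \<alpha> i m = \<gamma> m"
        using \<gamma>(2)[of "len g"] not_finite_existsD by auto
      then show ?thesis using \<alpha>(4) by (metis order_refl)
    qed
    have "\<xi> \<in> boundary G S" using \<xi> by blast
    then obtain x where x: "x \<in> \<xi>" using boundary_nonempty by blast
    have xc: "x i \<in> carrier G" for i using boundary_carrier \<xi> x by blast
    have \<gamma>c: "\<gamma> i \<in> carrier G" for i using ray_carrier \<gamma>(1) by blast
    have "eventually_ge K x \<gamma>" for K
    proof -
      obtain r where r: "r > 0" "\<And>\<xi> \<eta> x y. \<xi> \<in> boundary G S \<Longrightarrow> \<eta> \<in> boundary G S \<Longrightarrow> x \<in> \<xi> \<Longrightarrow> y \<in> \<eta> \<Longrightarrow>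
        \<rho> \<xi> \<eta> < r \<Longrightarrow> eventually_ge (K + 2 * \<delta>) x y"
        using small_distD[of "K + 2 * \<delta>"] by metis
      obtain i0 where i0: "inverse (real (Suc i0)) < r" using reals_Archimedean r(1) by blast
      obtain n where n: "\<And>i j. i \<ge> n \<Longrightarrow> j \<ge> n \<Longrightarrow> K + 2 * \<delta> \<le> gp (x i) (x j)"
        using boundary_eventually_ge[OF _ x x] \<xi> unfolding eventually_ge_def by blast
      obtain m :: nat where m: "K + 2 * \<delta> \<le> m" using real_arch_simple by blast
      have "K \<le> gp (x j) (\<gamma> l)" if j: "j \<ge> n" and l: "l \<ge> m" for j l
      proof -
        \<comment> \<open>This \<open>i\<close> is late enough for nearness to \<open>\<xi>\<close>
          and for agreement with \<open>\<gamma>\<close> up to \<open>l\<close>. The chain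
          \<open>x j\<close>, \<open>x q\<close>, \<open>\<alpha> i q\<close>,
          \<open>\<alpha> i l = \<gamma> l\<close> has two intermediate points, which use up the
          surplus \<open>2 * \<delta>\<close>.\<close>
        obtain i where i: "i \<ge> i0" "\<And>m. m \<le> l \<Longrightarrow> \<alpha> i m = \<gamma> m"
          using \<gamma>(2)[of l] unfolding infinite_nat_iff_unbounded_le by blast
        have "inverse (real (Suc i)) \<le> inverse (real (Suc i0))" using i(1) by (intro le_imp_inverse_le) auto
        then have "\<rho> \<xi> (\<eta> i) < r" using \<eta>(2)[of i] i0 by linarith
        then have "eventually_ge (K + 2 * \<delta>) x (\<alpha> i)" using r(2) \<xi> \<alpha>(1,2) x by blast
        then obtain p where p: "\<And>j q. j \<ge> p \<Longrightarrow> q \<ge> p \<Longrightarrow> K + 2 * \<delta> \<le> gp (x j) (\<alpha> i q)"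
          unfolding eventually_ge_def by blast
        define q where "q = max p (max n l)"
        have c: "\<alpha> i q \<in> carrier G" "\<alpha> i l \<in> carrier G" using ray_carrier[OF \<alpha>(3)] by auto
        have "gp (\<alpha> i l) (\<alpha> i q) = l"
          using gp_geodesic[of UNIV "\<alpha> i" l q] \<alpha>(3) by (simp add: q_def)
        then have "K + 2 * \<delta> \<le> gp (\<alpha> i q) (\<gamma> l)"
          using m l gp_sym[OF c(2,1)] i(2)[of l] by simp
        moreover have "K + 2 * \<delta> \<le> gp (x q) (\<alpha> i q)" using p by (simp add: q_def)
        ultimately have "K + 2 * \<delta> - \<delta> \<le> gp (x q) (\<gamma> l)"
          using gp_trans xc c \<gamma>c by blast
        moreover have "K + 2 * \<delta> - \<delta> \<le> gp (x j) (x q)"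
        proof -
          have "n \<le> q" by (simp add: q_def)
          then show ?thesis using n[OF j, of q] delta_nonneg by linarith
        qed
        ultimately have "K + 2 * \<delta> - \<delta> - \<delta> \<le> gp (x j) (\<gamma> l)"
          using gp_trans xc \<gamma>c by blast
        then show ?thesis by simp
      qed
      then show ?thesis unfolding eventually_ge_def by (intro exI[of _ "max n m"]) simp
    qed
    then have "\<gamma> \<in> \<xi>"
      using boundary_mem_iff[OF _ x] \<xi> ray_in_seqs[OF \<gamma>(1)] products_to_infinity_iff by blast
    then show False using spanI[OF _ _ \<gamma>(1), of \<xi> "len g"] g \<xi> by simp
  qed
qed

section \<open>The cover by interiors and its mesh\<close>

lemma S_set_eq: "S_set G S \<rho> g = bd.mtopology interior_of (span_nbhd g)"
  unfolding S_set_def span_nbhd_def ..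

lemma S_set_subset: "S_set G S \<rho> g \<subseteq> span_nbhd g"
  unfolding S_set_eq by (rule interior_of_subset)

text \<open>The spans missing \<open>\<xi>\<close> form a closed set, and every span containing \<open>\<xi>\<close> lies in
  \<open>span_nbhd g\<close>.\<close>

lemma span_subset_S_set:
  assumes g: "g \<in> carrier G"
  shows "span g \<subseteq> S_set G S \<rho> g"
proof
  fix \<xi> assume \<xi>: "\<xi> \<in> span g"
  let ?A = "{h \<in> carrier G. len h = len g \<and> \<xi> \<notin> span h}"
  have "finite ?A" by (rule finite_subset[OF _ finite_ball[of "len g"]]) auto
  then have "closedin bd.mtopology (\<Union>(span ` ?A))"
    using closedin_span by (intro closedin_Union) auto
  then have op: "openin bd.mtopology (boundary G S - \<Union>(span ` ?A))"
    using openin_diff[OF openin_topspace[of bd.mtopology]] by simp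
  have "boundary G S - \<Union>(span ` ?A) \<subseteq> span_nbhd g"
  proof
    fix \<eta> assume \<eta>: "\<eta> \<in> boundary G S - \<Union>(span ` ?A)"
    then have \<eta>b: "\<eta> \<in> boundary G S" by blast
    then obtain \<gamma> where \<gamma>: "\<gamma> \<in> \<eta>" "ray \<gamma>" using ray_to_boundary_point by metis
    let ?h = "\<gamma> (len g)"
    have h: "\<eta> \<in> span ?h" "?h \<in> carrier G" "len ?h = len g"
      using spanI[OF \<eta>b \<gamma>] ray_carrier[OF \<gamma>(2)] ray_len[OF \<gamma>(2)] by auto
    then have "\<xi> \<in> span ?h" using \<eta> by blast
    then show "\<eta> \<in> span_nbhd g" unfolding span_nbhd_iff[OF g] using h \<xi> by (intro exI[of _ ?h]) blast
  qed
  from interior_of_maximal[OF this op] show "\<xi> \<in> S_set G S \<rho> g"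
    unfolding S_set_eq using \<xi> span_boundary by blast
qed

lemma S_set_cover: "(\<Union>g\<in>{g \<in> carrier G. len g = n}. S_set G S \<rho> g) = boundary G S"
proof
  show "(\<Union>g\<in>{g \<in> carrier G. len g = n}. S_set G S \<rho> g) \<subseteq> boundary G S"
    using S_set_subset span_nbhd_boundary by blast
  show "boundary G S \<subseteq> (\<Union>g\<in>{g \<in> carrier G. len g = n}. S_set G S \<rho> g)"
  proof
    fix \<xi> assume \<xi>: "\<xi> \<in> boundary G S"
    then obtain \<gamma> where \<gamma>: "\<gamma> \<in> \<xi>" "ray \<gamma>" using ray_to_boundary_point by metis
    then have "\<gamma> n \<in> carrier G" "len (\<gamma> n) = n" "\<xi> \<in> span (\<gamma> n)"
      using spanI[OF \<xi>] ray_carrier ray_len by auto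
    then show "\<xi> \<in> (\<Union>g\<in>{g \<in> carrier G. len g = n}. S_set G S \<rho> g)"
      using span_subset_S_set by blast
  qed
qed

text \<open>Rays to two points of \<open>span_nbhd g\<close> pass, at distance \<open>len g\<close>,
  through points \<open>h\<close> and \<open>h'\<close> at most \<open>8 * \<delta>\<close> apart,
  so their products beyond are at least \<open>len g - 6 * \<delta>\<close>.\<close>

lemma span_nbhd_small:
  assumes "\<epsilon> > 0"
  obtains n\<^sub>0 where "\<And>g \<xi> \<eta>. g \<in> carrier G \<Longrightarrow> n\<^sub>0 \<le> len g \<Longrightarrow> \<xi> \<in> span_nbhd g \<Longrightarrow> \<eta> \<in> span_nbhd g \<Longrightarrow>
    \<rho> \<xi> \<eta> < \<epsilon>"
proof -
  obtain K where K: "\<And>\<xi> \<eta> x y. \<xi> \<in> boundary G S \<Longrightarrow> \<eta> \<in> boundary G S \<Longrightarrow> x \<in> \<xi> \<Longrightarrow> y \<in> \<eta> \<Longrightarrow>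
      eventually_ge K x y \<Longrightarrow> \<rho> \<xi> \<eta> < \<epsilon>"
    using small_dist[OF assms] by metis
  \<comment> \<open>Of the \<open>6 * \<delta>\<close>, half the distance bound for \<open>h\<close>
    and \<open>h'\<close> accounts for \<open>4 * \<delta>\<close>, and passing \<open>h\<close> and
    \<open>h'\<close> on the way from \<open>\<gamma> i\<close> to \<open>\<gamma>' j\<close> for
    the rest.\<close>
  obtain n\<^sub>0 :: nat where n\<^sub>0: "K + 6 * \<delta> \<le> n\<^sub>0" using real_arch_simple by blast
  have "\<rho> \<xi> \<eta> < \<epsilon>" if g: "g \<in> carrier G" "n\<^sub>0 \<le> len g" and \<xi>: "\<xi> \<in> span_nbhd g" and \<eta>: "\<eta> \<in> span_nbhd g"
    for g \<xi> \<eta>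
  proof -
    obtain h \<zeta> where h: "len h = len g" "\<zeta> \<in> span h" "\<zeta> \<in> span g" "\<xi> \<in> span h"
      using \<xi> span_nbhd_iff[OF g(1)] by blast
    obtain h' \<zeta>' where h': "len h' = len g" "\<zeta>' \<in> span h'" "\<zeta>' \<in> span g" "\<eta> \<in> span h'"
      using \<eta> span_nbhd_iff[OF g(1)] by blast
    obtain \<gamma> where \<gamma>: "\<xi> \<in> boundary G S" "\<gamma> \<in> \<xi>" "ray \<gamma>" "\<gamma> (len h) = h" using spanE h by blast
    obtain \<gamma>' where \<gamma>': "\<eta> \<in> boundary G S" "\<gamma>' \<in> \<eta>" "ray \<gamma>'" "\<gamma>' (len h') = h'" using spanE h' by blast
    have c: "\<gamma> i \<in> carrier G" "\<gamma>' i \<in> carrier G" "h \<in> carrier G" "h' \<in> carrier G" for i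
      using ray_carrier \<gamma>(3) \<gamma>'(3) span_carrier h(2) h'(2) by blast+
    have "wd h g \<le> 4 * \<delta>" "wd g h' \<le> 4 * \<delta>" using span_dist h h' by metis+
    then have "wd h h' \<le> 8 * \<delta>" using wd_triangle[of h g h'] c g by simp
    then have hh': "len g - 4 * \<delta> \<le> gp h h'" using gp_eq[OF c(3,4)] h(1) h'(1) by simp
    have "K \<le> gp (\<gamma> i) (\<gamma>' j)" if i: "i \<ge> len g" and j: "j \<ge> len g" for i j
    proof -
      have "len g \<le> gp (\<gamma> i) h" "len g \<le> gp h' (\<gamma>' j)"
        using gp_geodesic[of UNIV \<gamma> "len g" i] gp_geodesic[of UNIV \<gamma>' "len g" j] \<gamma> \<gamma>' h(1) h'(1) i j
          gp_sym[OF c(1,3)] by auto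
      then have 1: "len g - 4 * \<delta> \<le> gp (\<gamma> i) h" "len g - 4 * \<delta> - \<delta> \<le> gp h' (\<gamma>' j)"
        using delta_nonneg by linarith+
      have "len g - 4 * \<delta> - \<delta> \<le> gp (\<gamma> i) h'"
        using gp_trans[OF c(1,3,4) 1(1) hh'] .
      then have "len g - 4 * \<delta> - \<delta> - \<delta> \<le> gp (\<gamma> i) (\<gamma>' j)"
        using gp_trans[OF c(1,4,2) _ 1(2)] by blast
      then show ?thesis using n\<^sub>0 g(2) by simp
    qed
    then have "eventually_ge K \<gamma> \<gamma>'" unfolding eventually_ge_def by blast
    then show ?thesis using K \<gamma> \<gamma>' by blast
  qed
  then show thesis using that by blast
qed

lemma ediam_S_set_tendsto_0: "(\<lambda>n. SUP g\<in>{g \<in> carrier G. len g = n}. ediam \<rho> (S_set G S \<rho> g)) \<longlonglongrightarrow> 0"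
proof (rule tendsto_zero_ennreal)
  fix e :: real assume e: "0 < e"
  then obtain n\<^sub>0 where n\<^sub>0: "\<And>g \<xi> \<eta>. g \<in> carrier G \<Longrightarrow> n\<^sub>0 \<le> len g \<Longrightarrow> \<xi> \<in> span_nbhd g \<Longrightarrow>
      \<eta> \<in> span_nbhd g \<Longrightarrow> \<rho> \<xi> \<eta> < e / 2"
    using span_nbhd_small[of "e / 2"] by (metis half_gt_zero)
  \<comment> \<open>A supremum turns strict bounds into weak ones, hence half of
    \<open>e\<close>.\<close>
  have "(SUP g\<in>{g \<in> carrier G. len g = n}. ediam \<rho> (S_set G S \<rho> g)) \<le> ennreal (e / 2)"
    if n: "n \<ge> n\<^sub>0" for n
  proof (rule SUP_least)
    fix g assume g: "g \<in> {g \<in> carrier G. len g = n}"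
    show "ediam \<rho> (S_set G S \<rho> g) \<le> ennreal (e / 2)"
      unfolding ediam_def
    proof (intro SUP_least ennreal_leI)
      fix \<xi> \<eta> assume "\<xi> \<in> S_set G S \<rho> g" "\<eta> \<in> S_set G S \<rho> g"
      then show "\<rho> \<xi> \<eta> \<le> e / 2"
        using n\<^sub>0[of g \<xi> \<eta>] g n S_set_subset by (metis (mono_tags, lifting) less_imp_le mem_Collect_eq subsetD)
    qed
  qed
  moreover have "ennreal (e / 2) < ennreal e" using e by (simp add: ennreal_less_iff)
  ultimately have "\<forall>n\<ge>n\<^sub>0. (SUP g\<in>{g \<in> carrier G. len g = n}. ediam \<rho> (S_set G S \<rho> g)) < ennreal e"
    using le_less_trans by blast
  then show "\<forall>\<^sub>F n in sequentially. (SUP g\<in>{g \<in> carrier G. len g = n}. ediam \<rho> (S_set G S \<rho> g)) < ennreal e"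
    unfolding eventually_sequentially by blast
qed

lemma S_set_ancestor:
  assumes "x \<in> carrier G" "n \<le> len x"
  shows "\<exists>y\<in>carrier G. len y = n \<and> S_set G S \<rho> x \<subseteq> S_set G S \<rho> y"
  unfolding S_set_eq using span_nbhd_ancestor[OF assms] interior_of_mono by meson

end

section \<open>Translation of the interiors and the defining conditions\<close>

locale visual_ball_cone_group =
  visual_hyperbolic_group G S \<delta> \<rho> + ball_cone_group G S \<delta> N\<^sub>0
  for G (structure) and S and \<delta> and \<rho> and N\<^sub>0
begin

text \<open>A homeomorphism carries interiors to interiors, so the equality for
  \<open>span_nbhd\<close> passes to \<open>S_set\<close>.\<close>

lemma act_S_set:
  assumes "g \<in> carrier G" "x \<in> carrier G" "ball_type G S M x = ball_type G S M (g \<otimes> x)"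
    and "N\<^sub>0 + 4 * \<delta> \<le> M"
  shows "S_set G S \<rho> (g \<otimes> x) = act g ` S_set G S \<rho> x"
  unfolding S_set_eq act_span_nbhd[OF assms]
  using homeomorphic_map_interior_of[OF homeomorphic_map_act[OF assms(1)]] span_nbhd_boundary by simp

text \<open>Meeting sets force a displacement of at most \<open>12 * \<delta>\<close>; moving the
  ball type that far leaves radius \<open>N\<^sub>0 + 4 * \<delta>\<close>, enough for
  \<open>act_S_set\<close>. This is the source of \<open>16 * \<delta>\<close>.\<close>

lemma S_set_translate_neighbour:
  assumes g: "g \<in> carrier G" and x: "x \<in> carrier G" and y: "y \<in> carrier G"
    and eq: "ball_type G S N x = ball_type G S N (g \<otimes> x)" and N: "N\<^sub>0 + 16 * \<delta> \<le> N"
    and len: "len y = len x" and meet: "S_set G S \<rho> x \<inter> S_set G S \<rho> y \<noteq> {}"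
  shows "S_set G S \<rho> (g \<otimes> y) = act g ` S_set G S \<rho> y" "len (g \<otimes> y) = len (g \<otimes> x)"
proof -
  obtain \<xi> where "\<xi> \<in> span_nbhd x" "\<xi> \<in> span_nbhd y" using meet S_set_subset by blast
  then have d: "wd x y \<le> 12 * \<delta>" using span_nbhd_dist x y len by metis
  define h where "h = inv x \<otimes> y"
  have h: "h \<in> carrier G" "y = x \<otimes> h" "len h \<le> 12 * \<delta>"
    using x y d by (simp_all add: h_def inv_mult_cancel word_dist_def)
  have M: "len h + (N - len h) \<le> N" "N\<^sub>0 + 4 * \<delta> \<le> real (N - len h)" "len h + N\<^sub>0 \<le> N"
    using h(3) N delta_nonneg by linarith+
  have "ball_type G S (N - len h) y = ball_type G S (N - len h) (g \<otimes> y)"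
    using ball_type_mult[OF x _ h(1) eq M(1)] g x h by (simp add: m_assoc)
  then show "S_set G S \<rho> (g \<otimes> y) = act g ` S_set G S \<rho> y"
    using act_S_set[OF g y] M(2) by blast
  show "len (g \<otimes> y) = len (g \<otimes> x)"
    using translate_neighbour(2)[OF g x h(1) eq M(3)] h(2) len by simp
qed

lemma quasi_invariant_system_S_set:
  assumes N: "N\<^sub>0 + 16 * \<delta> \<le> N"
  shows "quasi_invariant_system_of_covers G S (boundary G S) \<rho> act (S_set G S \<rho>) (ball_type G S N)"
proof -
  \<comment> \<open>Every positive multiple of \<open>J\<close> is at least
    \<open>N + 8 * \<delta>\<close>, the gap that persistence of ball types asks for.\<close>
  define J where "J = N + nat \<lceil>8 * \<delta>\<rceil> + 1"
  have J: "J > 0" "N + 8 * \<delta> \<le> J" unfolding J_def by linarith+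
  have N4: "N\<^sub>0 + 4 * \<delta> \<le> N" and N8: "N\<^sub>0 + 8 * \<delta> \<le> N" using N delta_nonneg by linarith+
  \<comment> \<open>The added 1 keeps the neighbourhood constant positive even for
    \<open>\<delta> = 0\<close>.\<close>
  have far: "real (wd x y) \<le> 12 * \<delta> + 1"
    if xy: "x \<in> carrier G" "y \<in> carrier G" "len x = len y \<and> S_set G S \<rho> x \<inter> S_set G S \<rho> y \<noteq> {}" for x y
  proof -
    obtain \<xi> where "\<xi> \<in> span_nbhd x" "\<xi> \<in> span_nbhd y" using xy(3) S_set_subset by blast
    then show ?thesis using span_nbhd_dist[OF xy(1,2)] xy(3) by fastforce
  qed
  have jump: "\<exists>y\<in>carrier G. int (len y) = int (len x) - int k * int J \<and> S_set G S \<rho> x \<subseteq> S_set G S \<rho> y"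
    if x: "x \<in> carrier G" and k: "0 < k \<and> real k \<le> real (len x) / real J" for x k
  proof -
    have "real (k * J) \<le> real (len x)" using k J(1) by (simp add: field_simps)
    then have "k * J \<le> len x" by linarith
    then have "int (len x - k * J) = int (len x) - int k * int J" by (simp add: of_nat_diff)
    moreover obtain y where "y \<in> carrier G" "len y = len x - k * J" "S_set G S \<rho> x \<subseteq> S_set G S \<rho> y"
      using S_set_ancestor[OF x, of "len x - k * J"] by auto
    ultimately show ?thesis by (intro bexI[of _ y]) simp_all
  qed
  have descendant: "len (g \<otimes> y) = len (g \<otimes> x) + k * J \<and> ball_type G S N (g \<otimes> y) = ball_type G S N y \<and>
      S_set G S \<rho> (g \<otimes> y) = act g ` S_set G S \<rho> y"
    if g: "g \<in> carrier G" and x: "x \<in> carrier G" and y: "y \<in> carrier G"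
      and eq: "ball_type G S N x = ball_type G S N (g \<otimes> x)"
      and k: "0 < k \<and> len y = len x + k * J \<and> S_set G S \<rho> y \<noteq> {} \<and> S_set G S \<rho> y \<subseteq> S_set G S \<rho> x"
    for g x y k
  proof -
    \<comment> \<open>Nonemptiness and inclusion supply the common boundary point that ties the
      descendant \<open>y\<close> to \<open>x\<close>.\<close>
    obtain \<xi> where \<xi>: "\<xi> \<in> span_nbhd x" "\<xi> \<in> span_nbhd y" using k S_set_subset by blast
    have "J \<le> k * J" using k by simp
    then have "N + 8 * \<delta> \<le> real (k * J)" using J(2) by linarith
    note desc = ball_type_translate_descendant[OF g x y eq N8 _ this \<xi>]
    then show ?thesis using act_S_set[OF g y _ N4] k by simp
  qed
  have "quasi_invariant G S (boundary G S) \<rho> act (S_set G S \<rho>) (ball_type G S N)"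
    unfolding quasi_invariant_def
  proof (intro conjI exI[of _ "12 * \<delta> + 1"] exI[of _ J])
    show "acts_by_homeomorphisms G (boundary G S) \<rho> act" by (rule acts_by_homeomorphisms_boundary)
    show "type_function G (ball_type G S N)" unfolding type_function_def by (rule finite_ball_types)
    show "\<forall>x\<in>carrier G. S_set G S \<rho> x \<subseteq> boundary G S" using S_set_subset span_nbhd_boundary by blast
    show "0 < 12 * \<delta> + 1" using delta_nonneg by simp
    show "(\<lambda>n. SUP g\<in>{g \<in> carrier G. len g = n}. ediam \<rho> (S_set G S \<rho> g)) \<longlonglongrightarrow> 0"
      by (rule ediam_S_set_tendsto_0)
    show "\<forall>x\<in>carrier G. \<forall>y\<in>carrier G. len x = len y \<and> S_set G S \<rho> x \<inter> S_set G S \<rho> y \<noteq> {} \<longrightarrow>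
        real (wd x y) \<le> 12 * \<delta> + 1"
      using far by blast
    show "\<forall>x\<in>carrier G. \<forall>k::nat. 0 < k \<and> real k \<le> real (len x) / real J \<longrightarrow>
        (\<exists>y\<in>carrier G. int (len y) = int (len x) - int k * int J \<and> S_set G S \<rho> x \<subseteq> S_set G S \<rho> y)"
      using jump by blast
    show "\<forall>g\<in>carrier G. \<forall>x\<in>carrier G. ball_type G S N x = ball_type G S N (g \<otimes> x) \<longrightarrow>
        S_set G S \<rho> (g \<otimes> x) = act g ` S_set G S \<rho> x \<and>
        (\<forall>y\<in>carrier G. len y = len x \<and> S_set G S \<rho> x \<inter> S_set G S \<rho> y \<noteq> {} \<longrightarrow>
          S_set G S \<rho> (g \<otimes> y) = act g ` S_set G S \<rho> y \<and> len (g \<otimes> y) = len (g \<otimes> x)) \<and>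
        (\<forall>y\<in>carrier G. \<forall>k::nat.
          0 < k \<and> len y = len x + k * J \<and> S_set G S \<rho> y \<noteq> {} \<and> S_set G S \<rho> y \<subseteq> S_set G S \<rho> x \<longrightarrow>
          len (g \<otimes> y) = len (g \<otimes> x) + k * J \<and> ball_type G S N (g \<otimes> y) = ball_type G S N y \<and>
          S_set G S \<rho> (g \<otimes> y) = act g ` S_set G S \<rho> y)"
    proof (intro ballI impI conjI allI)
      fix g x assume g: "g \<in> carrier G" and x: "x \<in> carrier G"
        and eq: "ball_type G S N x = ball_type G S N (g \<otimes> x)"
      show "S_set G S \<rho> (g \<otimes> x) = act g ` S_set G S \<rho> x" by (rule act_S_set[OF g x eq N4])
      fix y assume y: "y \<in> carrier G"
      show "S_set G S \<rho> (g \<otimes> y) = act g ` S_set G S \<rho> y" "len (g \<otimes> y) = len (g \<otimes> x)"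
        if "len y = len x \<and> S_set G S \<rho> x \<inter> S_set G S \<rho> y \<noteq> {}"
        using S_set_translate_neighbour[OF g x y eq N conjunct1[OF that] conjunct2[OF that]] .
      fix k assume k: "0 < k \<and> len y = len x + k * J \<and> S_set G S \<rho> y \<noteq> {} \<and> S_set G S \<rho> y \<subseteq> S_set G S \<rho> x"
      note desc = descendant[OF g x y eq k]
      show "len (g \<otimes> y) = len (g \<otimes> x) + k * J" by (rule conjunct1[OF desc])
      show "ball_type G S N (g \<otimes> y) = ball_type G S N y" by (rule conjunct1[OF conjunct2[OF desc]])
      show "S_set G S \<rho> (g \<otimes> y) = act g ` S_set G S \<rho> y" by (rule conjunct2[OF conjunct2[OF desc]])
    qed
  qed (rule J(1))
  moreover have "openin bd.mtopology (S_set G S \<rho> x)" for x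
    unfolding S_set_eq by simp
  ultimately show ?thesis
    unfolding quasi_invariant_system_of_covers_def using S_set_cover by blast
qed

end

theorem corollary3p20:
  fixes G :: "('g, 'm) monoid_scheme"
    and S :: "'g set"
    and \<delta> :: real
    and N\<^sub>0 N :: nat
    and \<rho> :: "(nat \<Rightarrow> 'g) set \<Rightarrow> (nat \<Rightarrow> 'g) set \<Rightarrow> real"
  assumes "group G"
    and "finite S" and "S \<subseteq> carrier G" and "generate G S = carrier G"
    and "\<delta> \<ge> 1" and "delta_hyperbolic G S \<delta>"
    and "visual_metric G S \<rho>"
    and "\<forall>M\<ge>N\<^sub>0. \<forall>x\<in>carrier G. \<forall>y\<in>carrier G.
           ball_type G S M x = ball_type G S M y \<longrightarrow> cone_type G S x = cone_type G S y"
    and "real N \<ge> real N\<^sub>0 + 21 * \<delta>"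
  shows "quasi_invariant_system_of_covers G S (boundary G S) \<rho> (boundary_action G S)
           (S_set G S \<rho>) (ball_type G S N)"
proof -
  interpret group G by (rule assms(1))
  interpret visual_ball_cone_group G S \<delta> \<rho> N\<^sub>0
  proof unfold_locales
    show "0 \<le> \<delta>" using assms(5) by simp
    show "cone_type G S x = cone_type G S y"
      if "N\<^sub>0 \<le> M" "x \<in> carrier G" "y \<in> carrier G" "ball_type G S M x = ball_type G S M y" for M x y
      using assms(8) that by blast
  qed (fact assms)+
  have "N\<^sub>0 + 16 * \<delta> \<le> N" using assms(5,9) by linarith
  then show ?thesis by (rule quasi_invariant_system_S_set)
qed

end
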